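(* Let $m\geq 1$, let $0<a<b<\infty$ and $\Omega=B_b\setminus\overline{B}_a(0)\subset\mathbb{R}^2$. Assume that $$\log\left(\frac{b}{a}\right)\geq\frac{\pi\sqrt{2}}{\sqrt{2m-1}}.$$ Then, for all $u\in W^{2,2}_0(\Omega)$, $$\int_{\Omega}\left(\Delta u+2(m-1)\frac{x}{|x|^2}\cdot\nabla u+\frac{(m-1)^2}{|x|^2}u\right)^2dx\geq\left(4m^2+\frac{\pi^2}{\log^2\left(\frac{b}{a}\right)}\right)\frac{\pi^2}{\log^2\left(\frac{b}{a}\right)}\int_{\Omega}\frac{u^2}{|x|^4}dx.$$
   Context: $B_r=B_r(0)$ is the open ball of radius $r$ centred at $0$ in $\mathbb{R}^2$. $W^{2,2}_0(\Omega)$ is the closure of $C^\infty_c(\Omega)$ in $W^{2,2}(\Omega)$. *)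

theory Defs
  imports "HOL-Analysis.Analysis"
begin

definition partial_deriv :: "'n::finite \<Rightarrow> (real^'n \<Rightarrow> real) \<Rightarrow> real^'n \<Rightarrow> real" where
  "partial_deriv i f x = frechet_derivative f (at x) (axis i 1)"

text \<open>Derivatives of higher order are indexed by lists of coordinate directions:
  \<open>[i, j]\<close> stands for \<open>\<partial>\<^sub>i \<partial>\<^sub>j\<close> and the empty list for the function itself.\<close>

definition partial_derivs :: "'n::finite list \<Rightarrow> (real^'n \<Rightarrow> real) \<Rightarrow> real^'n \<Rightarrow> real" where
  "partial_derivs I f = foldr partial_deriv I f"

text \<open>Differentiability of all iterated partial derivatives makes them all continuous, so this
  is \<open>C\<^sup>\<infinity>\<close> on the whole space.\<close>

definition smooth :: "(real^'n::finite \<Rightarrow> real) \<Rightarrow> bool" where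
  "smooth f \<longleftrightarrow> (\<forall>I x. partial_derivs I f differentiable (at x))"

text \<open>\<open>C\<^sub>c\<^sup>\<infinity>(\<Omega>)\<close>, its elements being extended by zero to the whole space.\<close>

definition test_functions :: "(real^'n::finite) set \<Rightarrow> (real^'n \<Rightarrow> real) set" where
  "test_functions \<Omega> =
    {\<phi>. smooth \<phi> \<and> compact (closure {x. \<phi> x \<noteq> 0}) \<and> closure {x. \<phi> x \<noteq> 0} \<subseteq> \<Omega>}"

definition locally_integrable :: "(real^'n::finite) set \<Rightarrow> (real^'n \<Rightarrow> real) \<Rightarrow> bool" where
  "locally_integrable \<Omega> f \<longleftrightarrow> (\<forall>K. compact K \<and> K \<subseteq> \<Omega> \<longrightarrow> integrable (lebesgue_on K) f)"

definition has_weak_deriv ::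
  "(real^'n::finite) set \<Rightarrow> 'n list \<Rightarrow> (real^'n \<Rightarrow> real) \<Rightarrow> (real^'n \<Rightarrow> real) \<Rightarrow> bool" where
  "has_weak_deriv \<Omega> I u g \<longleftrightarrow>
    locally_integrable \<Omega> u \<and> locally_integrable \<Omega> g \<and>
    (\<forall>\<phi> \<in> test_functions \<Omega>.
      (LINT x|lebesgue_on \<Omega>. u x * partial_derivs I \<phi> x) =
      (-1) ^ length I * (LINT x|lebesgue_on \<Omega>. g x * \<phi> x))"

text \<open>Functions stand for their classes modulo equality almost everywhere on \<open>\<Omega>\<close>. For open
  \<open>\<Omega>\<close> any two weak derivatives agree almost everywhere on \<open>\<Omega>\<close>, so the choice below is
  immaterial under integrals over \<open>\<Omega>\<close>.\<close>

definition weak_deriv ::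
  "(real^'n::finite) set \<Rightarrow> 'n list \<Rightarrow> (real^'n \<Rightarrow> real) \<Rightarrow> real^'n \<Rightarrow> real" where
  "weak_deriv \<Omega> I u = (SOME g. has_weak_deriv \<Omega> I u g)"

definition weak_gradient :: "(real^'n::finite) set \<Rightarrow> (real^'n \<Rightarrow> real) \<Rightarrow> real^'n \<Rightarrow> real^'n" where
  "weak_gradient \<Omega> u x = (\<chi> i. weak_deriv \<Omega> [i] u x)"

definition weak_laplacian :: "(real^'n::finite) set \<Rightarrow> (real^'n \<Rightarrow> real) \<Rightarrow> real^'n \<Rightarrow> real" where
  "weak_laplacian \<Omega> u x = (\<Sum>i\<in>UNIV. weak_deriv \<Omega> [i, i] u x)"

definition L2_space :: "(real^'n::finite) set \<Rightarrow> (real^'n \<Rightarrow> real) set" where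
  "L2_space \<Omega> =
    {f \<in> borel_measurable (lebesgue_on \<Omega>). integrable (lebesgue_on \<Omega>) (\<lambda>x. (f x)\<^sup>2)}"

text \<open>\<open>W\<^sup>k\<^sup>,\<^sup>2(\<Omega>)\<close>\<close>

definition sobolev_space :: "nat \<Rightarrow> (real^'n::finite) set \<Rightarrow> (real^'n \<Rightarrow> real) set" where
  "sobolev_space k \<Omega> =
    {u \<in> L2_space \<Omega>. \<forall>I. length I \<le> k \<longrightarrow> (\<exists>g \<in> L2_space \<Omega>. has_weak_deriv \<Omega> I u g)}"

text \<open>The sum ranges over a finite set of lists. A mixed derivative is counted once for each order
  of its directions, so for \<open>k = 2\<close> this is \<open>(\<parallel>u\<parallel>\<^sup>2 + \<parallel>\<nabla>u\<parallel>\<^sup>2 + \<parallel>\<nabla>\<^sup>2u\<parallel>\<^sup>2)\<^sup>1\<^sup>/\<^sup>2\<close> with the Euclidean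
  norm of the Hessian matrix.\<close>

definition sobolev_norm :: "nat \<Rightarrow> (real^'n::finite) set \<Rightarrow> (real^'n \<Rightarrow> real) \<Rightarrow> real" where
  "sobolev_norm k \<Omega> u =
    sqrt (\<Sum>I | length I \<le> k. LINT x|lebesgue_on \<Omega>. (weak_deriv \<Omega> I u x)\<^sup>2)"

text \<open>\<open>W\<^sub>0\<^sup>k\<^sup>,\<^sup>2(\<Omega>)\<close>, the closure of \<open>C\<^sub>c\<^sup>\<infinity>(\<Omega>)\<close> in \<open>W\<^sup>k\<^sup>,\<^sup>2(\<Omega>)\<close>\<close>

definition sobolev_space_0 :: "nat \<Rightarrow> (real^'n::finite) set \<Rightarrow> (real^'n \<Rightarrow> real) set" where
  "sobolev_space_0 k \<Omega> =
    {u \<in> sobolev_space k \<Omega>. \<forall>\<epsilon>>0. \<exists>\<phi> \<in> test_functions \<Omega>. sobolev_norm k \<Omega> (\<lambda>x. u x - \<phi> x) < \<epsilon>}"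

end

theory Submission
  imports Defs
begin

text \<open>
  Put \<open>t = ln |x|\<close> and write \<open>u = |x| w\<close>. In the coordinates \<open>(t, \<theta>)\<close> one has
  \<open>dx / |x|\<^sup>2 = dt d\<theta>\<close>, so \<open>\<integral> u\<^sup>2 / |x|\<^sup>4 dx = \<integral> w\<^sup>2 dt d\<theta>\<close>, and the operator of the theorem becomes
  \<open>|x| ((\<partial>\<^sub>t + m)\<^sup>2 + \<partial>\<^sub>\<theta>\<^sup>2) w / |x|\<^sup>2\<close>. On functions of \<open>x\<close>, the derivatives \<open>\<partial>\<^sub>t\<close> and \<open>\<partial>\<^sub>\<theta>\<close> of \<open>w\<close> are the
  operators \<open>T = x \<bullet> \<nabla> - 1\<close> and \<open>S = x\<^sub>1 \<partial>\<^sub>2 - x\<^sub>2 \<partial>\<^sub>1\<close> applied to \<open>u\<close>. They commute and are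
  skew-symmetric for the form \<open>\<langle>f, g\<rangle> = \<integral> f g / |x|\<^sup>4 dx\<close>, so the argument in logarithmic polar
  coordinates can be carried out with \<open>T\<close> and \<open>S\<close> on test functions in the plane.

  Write \<open>\<parallel>f\<parallel>\<^sup>2 = \<langle>f, f\<rangle>\<close> and \<open>\<kappa> = \<pi>\<^sup>2 / ln\<^sup>2 (b / a)\<close>. Expanding the square and integrating by
  parts (\<open>energy_identity\<close>) gives
  \<open>\<parallel>(T + m)\<^sup>2 f + S\<^sup>2 f\<parallel>\<^sup>2 = \<parallel>T\<^sup>2 f\<parallel>\<^sup>2 + 2 m\<^sup>2 \<parallel>T f\<parallel>\<^sup>2 + m\<^sup>4 \<parallel>f\<parallel>\<^sup>2 + \<parallel>S\<^sup>2 f\<parallel>\<^sup>2 + 2 \<parallel>T S f\<parallel>\<^sup>2 - 2 m\<^sup>2 \<parallel>S f\<parallel>\<^sup>2\<close>.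
  Along each ray \<open>w\<close> vanishes at both ends of an interval of length \<open>ln (b / a)\<close>, whence
  \<open>\<parallel>T g\<parallel>\<^sup>2 \<ge> \<kappa> \<parallel>g\<parallel>\<^sup>2\<close> (\<open>poincare_annulus\<close>). Its derivative \<open>\<partial>\<^sub>t w\<close> vanishes at both ends and has mean
  zero in addition, and then the constant is four times as large:
  \<open>\<parallel>T\<^sup>2 f\<parallel>\<^sup>2 \<ge> 4 \<kappa> \<parallel>T f\<parallel>\<^sup>2\<close> (\<open>buckling_annulus\<close>). The only negative term of the identity is absorbed by
  \<open>2 \<parallel>T S f\<parallel>\<^sup>2 \<ge> 2 \<kappa> \<parallel>S f\<parallel>\<^sup>2\<close> and by
  \<open>0 \<le> \<parallel>S\<^sup>2 f + (m\<^sup>2 - \<kappa>) f\<parallel>\<^sup>2 = \<parallel>S\<^sup>2 f\<parallel>\<^sup>2 - 2 (m\<^sup>2 - \<kappa>) \<parallel>S f\<parallel>\<^sup>2 + (m\<^sup>2 - \<kappa>)\<^sup>2 \<parallel>f\<parallel>\<^sup>2\<close>.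
  What remains is at least \<open>(4 m\<^sup>2 \<kappa> + 3 \<kappa>\<^sup>2) \<parallel>f\<parallel>\<^sup>2\<close>, which exceeds the claim
  (\<open>operator_lower_bound\<close>).

  Both of these inequalities are obtained by completing a square with radial weights that solve
  equations of Riccati type. The weights are smooth in the open annulus and may blow up only at the
  boundary circles, away from the supports of test functions, so that they can be used in the
  integration by parts over the plane.

  Both sides of the claim are continuous in the Sobolev norm, since the coefficients are bounded on
  the annulus, and so the inequality extends from test functions to their closure. The weak
  derivatives in the statement are chosen by an indefinite description; to relate the ones of
  \<open>u\<close>, of a test function \<open>\<phi>\<close> and of \<open>u - \<phi>\<close>, one needs that weak derivatives are unique almost
  everywhere. This is the fundamental lemma of the calculus of variations (\<open>fundamental_lemma\<close>): a
  locally integrable function orthogonal to all test functions has vanishing integral over every box,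
  by approximation of the indicator function of the box with smooth bumps, and is therefore zero by
  Lebesgue's differentiation theorem.
\<close>

section \<open>Smooth functions and their partial derivatives\<close>

lemma partial_deriv_eqI:
  "(f has_derivative D) (at x) \<Longrightarrow> partial_deriv i f x = D (axis i 1)"
  unfolding partial_deriv_def by (metis frechet_derivative_at)

lemma has_derivative_partial_derivs:
  fixes f :: "real^'n::finite \<Rightarrow> real"
  assumes "f differentiable (at x)"
  shows "(f has_derivative (\<lambda>v. \<Sum>i\<in>UNIV. partial_deriv i f x * v $ i)) (at x)"
proof -
  have D: "(f has_derivative frechet_derivative f (at x)) (at x)"
    using assms frechet_derivative_works by blast
  interpret linear "frechet_derivative f (at x)"
    using D has_derivative_linear by blast
  have "frechet_derivative f (at x) v = (\<Sum>i\<in>UNIV. partial_deriv i f x * v $ i)" for v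
  proof -
    have "v = (\<Sum>i\<in>UNIV. v $ i *\<^sub>R axis i 1)"
      using basis_expansion[of v] by (simp add: scalar_mult_eq_scaleR)
    then have "frechet_derivative f (at x) v
        = frechet_derivative f (at x) (\<Sum>i\<in>UNIV. v $ i *\<^sub>R axis i 1)"
      by (rule arg_cong)
    also have "\<dots> = (\<Sum>i\<in>UNIV. frechet_derivative f (at x) (v $ i *\<^sub>R axis i 1))"
      by (rule sum)
    also have "\<dots> = (\<Sum>i\<in>UNIV. partial_deriv i f x * v $ i)"
      by (simp add: scale partial_deriv_def mult.commute)
    finally show ?thesis .
  qed
  then have "frechet_derivative f (at x) = (\<lambda>v. \<Sum>i\<in>UNIV. partial_deriv i f x * v $ i)" ..
  then show ?thesis using D by simp
qed

lemma partial_deriv_const: "partial_deriv i (\<lambda>x. c) = (\<lambda>x. 0)"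
  by (rule ext, subst partial_deriv_eqI[OF has_derivative_const]) simp

lemma partial_deriv_coord:
  "partial_deriv i (\<lambda>x. x $ j) = (\<lambda>x. if i = j then 1 else 0)"
proof
  fix x :: "real^'a"
  have "((\<lambda>x::real^'a. x $ j) has_derivative (\<lambda>v. v $ j)) (at x)"
    by (intro bounded_linear_imp_has_derivative bounded_linear_vec_nth)
  from partial_deriv_eqI[OF this]
  show "partial_deriv i (\<lambda>x. x $ j) x = (if i = j then 1 else 0)"
    by (simp add: axis_def)
qed

lemma partial_deriv_add:
  assumes "f differentiable (at x)" "g differentiable (at x)"
  shows "partial_deriv i (\<lambda>x. f x + g x) x = partial_deriv i f x + partial_deriv i g x"
  using has_derivative_add[OF assms[THEN has_derivative_partial_derivs], THEN partial_deriv_eqI]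
  by (simp add: axis_def if_distrib cong: if_cong)

lemma partial_deriv_diff:
  assumes "f differentiable (at x)" "g differentiable (at x)"
  shows "partial_deriv i (\<lambda>x. f x - g x) x = partial_deriv i f x - partial_deriv i g x"
  using has_derivative_diff[OF assms[THEN has_derivative_partial_derivs], THEN partial_deriv_eqI]
  by (simp add: axis_def if_distrib cong: if_cong)

lemma partial_deriv_mult:
  assumes "f differentiable (at x)" "g differentiable (at x)"
  shows "partial_deriv i (\<lambda>x. f x * g x) x = partial_deriv i f x * g x + f x * partial_deriv i g x"
  using has_derivative_mult[OF assms[THEN has_derivative_partial_derivs], THEN partial_deriv_eqI]
  by (simp add: axis_def if_distrib cong: if_cong)

text \<open>Smoothness is the largest property that implies differentiability and is stable under partial
  derivatives, which gives a proof principle by coinduction.\<close>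

lemma smooth_coinduct:
  assumes "f \<in> S"
    and "\<And>f x. f \<in> S \<Longrightarrow> f differentiable (at x)"
    and "\<And>f i. f \<in> S \<Longrightarrow> partial_deriv i f \<in> S"
  shows "smooth f"
proof -
  have "partial_derivs I f \<in> S" for I
    by (induction I) (auto simp: partial_derivs_def assms)
  then show ?thesis using assms(2) by (auto simp: smooth_def)
qed

lemma smooth_differentiable: "smooth f \<Longrightarrow> f differentiable (at x)"
  unfolding smooth_def partial_derivs_def by (metis foldr.simps(1) id_apply)

lemma smooth_partial_deriv: "smooth f \<Longrightarrow> smooth (partial_deriv i f)"
proof -
  assume f: "smooth f"
  have "partial_derivs I (partial_deriv i f) = partial_derivs (I @ [i]) f" for I
    by (simp add: partial_derivs_def)
  then show ?thesis using f unfolding smooth_def by metis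
qed

lemma smooth_continuous_on: "smooth f \<Longrightarrow> continuous_on A f"
  by (meson continuous_at_imp_continuous_on differentiable_imp_continuous_within
      smooth_differentiable)

text \<open>A partial derivative of a product is a sum of products. Sums and products of smooth functions
  are therefore treated together, as a single class stable under partial derivatives.\<close>

inductive smooth_term :: "(real^'n::finite \<Rightarrow> real) \<Rightarrow> bool" where
  base: "smooth f \<Longrightarrow> smooth_term f"
| add: "smooth_term f \<Longrightarrow> smooth_term g \<Longrightarrow> smooth_term (\<lambda>x. f x + g x)"
| mult: "smooth_term f \<Longrightarrow> smooth_term g \<Longrightarrow> smooth_term (\<lambda>x. f x * g x)"

lemma smooth_term_imp_smooth:
  fixes f :: "real^'n::finite \<Rightarrow> real"
  assumes "smooth_term f"
  shows "smooth f"
proof (rule smooth_coinduct[of f "Collect smooth_term"])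
  have D: "g differentiable (at x)" if "smooth_term g" for g and x :: "real^'n"
    using that by induction (auto simp: smooth_differentiable)
  show "g differentiable (at x)" if "g \<in> Collect smooth_term" for g and x :: "real^'n"
    using that D by auto
  have "smooth_term (partial_deriv i g)" if "smooth_term g" for g and i :: 'n
    using that
  proof induction
    case (base f)
    then show ?case by (simp add: smooth_partial_deriv smooth_term.base)
  next
    case (add f g)
    have "partial_deriv i (\<lambda>x. f x + g x) = (\<lambda>x. partial_deriv i f x + partial_deriv i g x)"
      using add D by (auto simp: partial_deriv_add)
    then show ?case using add by (simp add: smooth_term.add)
  next
    case (mult f g)
    have "partial_deriv i (\<lambda>x. f x * g x)
        = (\<lambda>x. partial_deriv i f x * g x + f x * partial_deriv i g x)"
      using mult D by (auto simp: partial_deriv_mult)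
    then show ?case using mult by (simp add: smooth_term.add smooth_term.mult)
  qed
  then show "partial_deriv i g \<in> Collect smooth_term" if "g \<in> Collect smooth_term" for g and i :: 'n
    using that by auto
qed (use assms in auto)

lemma smooth_add: "smooth f \<Longrightarrow> smooth g \<Longrightarrow> smooth (\<lambda>x. f x + g x)"
  by (rule smooth_term_imp_smooth) (rule smooth_term.add; rule smooth_term.base)

lemma smooth_mult: "smooth f \<Longrightarrow> smooth g \<Longrightarrow> smooth (\<lambda>x. f x * g x)"
  by (rule smooth_term_imp_smooth) (rule smooth_term.mult; rule smooth_term.base)

lemma smooth_const: "smooth (\<lambda>x::real^'n::finite. c)"
proof (rule smooth_coinduct)
  let ?S = "range (\<lambda>c::real. \<lambda>x::real^'n. c)"
  show "(\<lambda>x::real^'n. c) \<in> ?S" by (rule rangeI)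
  show "f differentiable (at x)" if "f \<in> ?S" for f x
    using that by (elim rangeE) simp
  show "partial_deriv i f \<in> ?S" if "f \<in> ?S" for f i
    using that by (elim rangeE) (simp add: partial_deriv_const)
qed

lemma smooth_diff: "smooth f \<Longrightarrow> smooth g \<Longrightarrow> smooth (\<lambda>x. f x - g x)"
  using smooth_add[of f "\<lambda>x. (-1) * g x"] smooth_mult[OF smooth_const, of g "-1"] by simp

lemma smooth_coord: "smooth (\<lambda>x::real^'n::finite. x $ j)"
proof (rule smooth_coinduct)
  let ?S = "insert (\<lambda>x::real^'n. x $ j) (range (\<lambda>c x. c))"
  have d: "(\<lambda>x::real^'n. x $ j) differentiable (at x)" for x
    by (rule bounded_linear_imp_differentiable[OF bounded_linear_vec_nth])
  show "(\<lambda>x::real^'n. x $ j) \<in> ?S" by simp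
  show "f differentiable (at x)" if "f \<in> ?S" for f x
    using that d by (elim insertE rangeE) simp_all
  show "partial_deriv i f \<in> ?S" if "f \<in> ?S" for f i
    using that by (elim insertE rangeE) (simp_all add: partial_deriv_const partial_deriv_coord)
qed

lemma smooth_prod:
  assumes "\<And>i. i \<in> A \<Longrightarrow> smooth (f i)"
  shows "smooth (\<lambda>x. \<Prod>i\<in>A. f i x)"
  using assms
  by (induction A rule: infinite_finite_induct) (auto intro: smooth_const smooth_mult)

lemma has_derivative_along_axis:
  fixes f :: "real^'n::finite \<Rightarrow> real"
  assumes "f differentiable (at (x + t *\<^sub>R axis i 1))"
  shows "((\<lambda>t. f (x + t *\<^sub>R axis i 1)) has_real_derivative
    partial_deriv i f (x + t *\<^sub>R axis i 1)) (at t)"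
proof -
  define l where "l = (\<lambda>t::real. x + t *\<^sub>R axis i 1)"
  have l: "(l has_derivative (\<lambda>s. s *\<^sub>R axis i 1)) (at t)"
    unfolding l_def by (auto intro!: derivative_eq_intros)
  have "(f has_derivative (\<lambda>v. \<Sum>k\<in>UNIV. partial_deriv k f (l t) * v $ k)) (at (l t))"
    using assms by (simp add: has_derivative_partial_derivs l_def)
  from has_derivative_compose[OF l this]
  have "((\<lambda>t. f (l t)) has_derivative (\<lambda>s. partial_deriv i f (l t) * s)) (at t)"
    by (simp add: axis_def if_distrib cong: if_cong)
  then show ?thesis
    by (simp add: l_def has_field_derivative_def)
qed

text \<open>Both orders of mixed differentiation are limits of the same second difference quotient,
  by two applications of the mean value theorem.\<close>

lemma smooth_partial_deriv_commute:
  fixes f :: "real^'n::finite \<Rightarrow> real"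
  assumes f: "smooth f"
  shows "partial_deriv i (partial_deriv j f) = partial_deriv j (partial_deriv i f)"
proof -
  define e where "e k = (axis k 1 :: real^'n)" for k
  define Q where "Q x h = f (x + h *\<^sub>R e i + h *\<^sub>R e j) - f (x + h *\<^sub>R e i)
      - f (x + h *\<^sub>R e j) + f x" for x h
  have mv: "\<exists>y. norm (y - x) \<le> 2 * h \<and>
      f (x + h *\<^sub>R e i + h *\<^sub>R e j) - f (x + h *\<^sub>R e i) - f (x + h *\<^sub>R e j) + f x
      = h * h * partial_deriv j (partial_deriv i f) y" if h: "h > 0" for x h i j
  proof -
    have d1: "((\<lambda>s. f (x + h *\<^sub>R e j + s *\<^sub>R e i) - f (x + s *\<^sub>R e i)) has_real_derivative
        partial_deriv i f (x + h *\<^sub>R e j + s *\<^sub>R e i) - partial_deriv i f (x + s *\<^sub>R e i)) (at s)" for s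
      unfolding e_def
      by (intro DERIV_diff has_derivative_along_axis smooth_differentiable f)
    obtain s where s: "0 < s" "s < h" and
      s2: "(f (x + h *\<^sub>R e j + h *\<^sub>R e i) - f (x + h *\<^sub>R e i)) - (f (x + h *\<^sub>R e j + 0 *\<^sub>R e i) - f (x + 0 *\<^sub>R e i))
        = (h - 0) * (partial_deriv i f (x + h *\<^sub>R e j + s *\<^sub>R e i) - partial_deriv i f (x + s *\<^sub>R e i))"
      using MVT2[OF h d1] by blast
    have d2: "((\<lambda>t. partial_deriv i f (x + s *\<^sub>R e i + t *\<^sub>R e j)) has_real_derivative
        partial_deriv j (partial_deriv i f) (x + s *\<^sub>R e i + t *\<^sub>R e j)) (at t)" for t
      unfolding e_def
      by (intro has_derivative_along_axis smooth_differentiable smooth_partial_deriv f)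
    obtain t where t: "0 < t" "t < h" and
      t2: "partial_deriv i f (x + s *\<^sub>R e i + h *\<^sub>R e j) - partial_deriv i f (x + s *\<^sub>R e i + 0 *\<^sub>R e j)
        = (h - 0) * partial_deriv j (partial_deriv i f) (x + s *\<^sub>R e i + t *\<^sub>R e j)"
      using MVT2[OF h d2] by blast
    \<comment> \<open>the intermediate point stays within distance \<open>2 h\<close> of \<open>x\<close>\<close>
    have "norm (s *\<^sub>R e i + t *\<^sub>R e j) \<le> s + t"
      using norm_triangle_ineq[of "s *\<^sub>R e i" "t *\<^sub>R e j"] s t by (simp add: e_def)
    then have "norm (x + s *\<^sub>R e i + t *\<^sub>R e j - x) \<le> 2 * h"
      using s t by (simp add: add.assoc)
    moreover have "f (x + h *\<^sub>R e i + h *\<^sub>R e j) - f (x + h *\<^sub>R e i) - f (x + h *\<^sub>R e j) + f x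
      = h * h * partial_deriv j (partial_deriv i f) (x + s *\<^sub>R e i + t *\<^sub>R e j)"
      using s2 t2 by (simp add: algebra_simps)
    ultimately show ?thesis by blast
  qed
  have lim: "((\<lambda>n. Q x (1 / Suc n) / (1 / Suc n)^2) \<longlongrightarrow> partial_deriv j (partial_deriv i f) x) sequentially"
    if Q: "\<And>x h. Q x h = f (x + h *\<^sub>R e i + h *\<^sub>R e j) - f (x + h *\<^sub>R e i) - f (x + h *\<^sub>R e j) + f x"
    for i j x Q
  proof -
    have "\<forall>n. \<exists>y. norm (y - x) \<le> 2 * (1 / Suc n) \<and>
      Q x (1 / Suc n) = (1 / Suc n) * (1 / Suc n) * partial_deriv j (partial_deriv i f) y"
      unfolding Q by (intro allI mv) simp
    then obtain y where y: "\<And>n. norm (y n - x) \<le> 2 * (1 / Suc n)"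
      "\<And>n. Q x (1 / Suc n) = (1 / Suc n) * (1 / Suc n) * partial_deriv j (partial_deriv i f) (y n)"
      by metis
    have "(\<lambda>n. 2 * (1 / real (Suc n))) \<longlonglongrightarrow> 0"
      using tendsto_mult_right_zero[OF LIMSEQ_inverse_real_of_nat, of 2] by (simp add: field_simps)
    then have "(\<lambda>n. y n - x) \<longlonglongrightarrow> 0"
      by (rule Lim_null_comparison[rotated]) (use y in auto)
    then have "y \<longlonglongrightarrow> x" by (simp add: LIM_zero_iff)
    moreover have "isCont (partial_deriv j (partial_deriv i f)) x"
      by (intro differentiable_imp_continuous_within smooth_differentiable smooth_partial_deriv f)
    ultimately have "(\<lambda>n. partial_deriv j (partial_deriv i f) (y n)) \<longlonglongrightarrow> partial_deriv j (partial_deriv i f) x"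
      using isCont_tendsto_compose by blast
    moreover have "Q x (1 / Suc n) / (1 / Suc n)^2 = partial_deriv j (partial_deriv i f) (y n)" for n
      unfolding y(2)[of n] by (simp add: power2_eq_square)
    ultimately show ?thesis by (simp only: )
  qed
  show ?thesis
  proof
    fix x
    have "((\<lambda>n. Q x (1 / Suc n) / (1 / Suc n)^2) \<longlongrightarrow> partial_deriv j (partial_deriv i f) x) sequentially"
      by (rule lim) (simp add: Q_def)
    moreover have "((\<lambda>n. Q x (1 / Suc n) / (1 / Suc n)^2) \<longlongrightarrow> partial_deriv i (partial_deriv j f) x) sequentially"
      by (rule lim) (simp add: Q_def algebra_simps)
    ultimately show "partial_deriv i (partial_deriv j f) x = partial_deriv j (partial_deriv i f) x"
      using LIMSEQ_unique by blast
  qed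
qed

section \<open>Integration by parts for compactly supported functions\<close>

text \<open>Any compact set may witness the support condition, not only the closure of the set where the
  function does not vanish. This makes closure under algebraic operations immediate.\<close>

definition supported_in :: "(real^'n::finite) set \<Rightarrow> (real^'n \<Rightarrow> real) \<Rightarrow> bool" where
  "supported_in \<Omega> f \<longleftrightarrow> (\<exists>K. compact K \<and> K \<subseteq> \<Omega> \<and> (\<forall>x. x \<notin> K \<longrightarrow> f x = 0))"

definition C0c :: "(real^'n::finite) set \<Rightarrow> (real^'n \<Rightarrow> real) set" where
  "C0c \<Omega> = {f. continuous_on UNIV f \<and> supported_in \<Omega> f}"

definition C1c :: "(real^'n::finite) set \<Rightarrow> (real^'n \<Rightarrow> real) set" where
  "C1c \<Omega> = {f. (\<forall>x. f differentiable (at x)) \<and> (\<forall>i. continuous_on UNIV (partial_deriv i f))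
      \<and> supported_in \<Omega> f}"

lemma test_functions_iff: "f \<in> test_functions \<Omega> \<longleftrightarrow> smooth f \<and> supported_in \<Omega> f"
proof -
  have "compact (closure {x. f x \<noteq> 0}) \<and> closure {x. f x \<noteq> 0} \<subseteq> \<Omega>" if "supported_in \<Omega> f"
  proof -
    obtain K where K: "compact K" "K \<subseteq> \<Omega>" "\<forall>x. x \<notin> K \<longrightarrow> f x = 0"
      using \<open>supported_in \<Omega> f\<close> unfolding supported_in_def by blast
    then have "closure {x. f x \<noteq> 0} \<subseteq> K"
      by (intro closure_minimal) (auto intro: compact_imp_closed)
    then show ?thesis
      using K compact_Int_closed[OF K(1) closed_closure, of "{x. f x \<noteq> 0}"]
      by (auto simp: Int_absorb1)
  qed
  moreover have "supported_in \<Omega> f"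
    if "compact (closure {x. f x \<noteq> 0})" "closure {x. f x \<noteq> 0} \<subseteq> \<Omega>"
    using that closure_subset[of "{x. f x \<noteq> 0}"] unfolding supported_in_def by blast
  ultimately show ?thesis unfolding test_functions_def by blast
qed

lemma supported_in_vanish:
  assumes "supported_in \<Omega> f" "\<And>x. f x = 0 \<Longrightarrow> g x = 0"
  shows "supported_in \<Omega> g"
  using assms unfolding supported_in_def by meson

lemma supported_in_combine:
  assumes "supported_in \<Omega> f" "supported_in \<Omega> g" "\<And>x. f x = 0 \<Longrightarrow> g x = 0 \<Longrightarrow> h x = 0"
  shows "supported_in \<Omega> h"
proof -
  obtain K L where "compact K" "K \<subseteq> \<Omega>" "\<forall>x. x \<notin> K \<longrightarrow> f x = 0"
    "compact L" "L \<subseteq> \<Omega>" "\<forall>x. x \<notin> L \<longrightarrow> g x = 0"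
    using assms unfolding supported_in_def by blast
  then show ?thesis using assms(3) unfolding supported_in_def
    by (intro exI[of _ "K \<union> L"]) auto
qed

lemma partial_deriv_outside_closed:
  assumes "closed K" "\<And>x. x \<notin> K \<Longrightarrow> f x = 0" "x \<notin> K"
  shows "partial_deriv i f x = 0"
proof -
  have "(f has_derivative (\<lambda>v. 0)) (at x)"
    by (rule has_derivative_transform_within_open[of "\<lambda>x. 0" _ _ _ "-K"])
      (use assms in \<open>auto simp: open_Compl\<close>)
  from partial_deriv_eqI[OF this] show ?thesis by simp
qed

lemma supported_in_partial_deriv:
  assumes "supported_in \<Omega> f"
  shows "supported_in \<Omega> (partial_deriv i f)"
  using assms partial_deriv_outside_closed compact_imp_closed
  unfolding supported_in_def by metis

lemma C1c_imp_C0c: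
  assumes "f \<in> C1c \<Omega>"
  shows "f \<in> C0c \<Omega>"
proof -
  have "isCont f x" for x
    using assms by (intro differentiable_imp_continuous_within) (simp add: C1c_def)
  then show ?thesis
    using assms by (simp add: C0c_def C1c_def continuous_at_imp_continuous_on)
qed

lemma partial_deriv_C0c: "f \<in> C1c \<Omega> \<Longrightarrow> partial_deriv i f \<in> C0c \<Omega>"
  by (simp add: C0c_def C1c_def supported_in_partial_deriv)

lemma test_smooth: "f \<in> test_functions \<Omega> \<Longrightarrow> smooth f"
  by (simp add: test_functions_iff)

lemma test_imp_C1c: "f \<in> test_functions \<Omega> \<Longrightarrow> f \<in> C1c \<Omega>"
  by (simp add: test_functions_iff C1c_def smooth_differentiable smooth_continuous_on
      smooth_partial_deriv)

lemma test_imp_C0c: "f \<in> test_functions \<Omega> \<Longrightarrow> f \<in> C0c \<Omega>"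
  by (intro C1c_imp_C0c test_imp_C1c)

lemma test_add:
  assumes "f \<in> test_functions \<Omega>" "g \<in> test_functions \<Omega>"
  shows "(\<lambda>x. f x + g x) \<in> test_functions \<Omega>"
  using assms supported_in_combine[of \<Omega> f g "\<lambda>x. f x + g x"]
  by (simp add: test_functions_iff smooth_add)

lemma test_diff:
  assumes "f \<in> test_functions \<Omega>" "g \<in> test_functions \<Omega>"
  shows "(\<lambda>x. f x - g x) \<in> test_functions \<Omega>"
  using assms supported_in_combine[of \<Omega> f g "\<lambda>x. f x - g x"]
  by (simp add: test_functions_iff smooth_diff)

lemma test_mult:
  assumes "smooth f" "g \<in> test_functions \<Omega>"
  shows "(\<lambda>x. f x * g x) \<in> test_functions \<Omega>"
  using assms supported_in_vanish[of \<Omega> g "\<lambda>x. f x * g x"]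
  by (simp add: test_functions_iff smooth_mult)

lemma test_partial_deriv: "f \<in> test_functions \<Omega> \<Longrightarrow> partial_deriv i f \<in> test_functions \<Omega>"
  by (simp add: test_functions_iff smooth_partial_deriv supported_in_partial_deriv)

lemma test_partial_derivs: "f \<in> test_functions \<Omega> \<Longrightarrow> partial_derivs I f \<in> test_functions \<Omega>"
  by (induction I) (simp_all add: partial_derivs_def test_partial_deriv)

lemma C0c_integrable:
  assumes "f \<in> C0c \<Omega>"
  shows "integrable lborel f"
proof -
  obtain K where K: "compact K" "\<forall>x. x \<notin> K \<longrightarrow> f x = 0"
    using assms unfolding C0c_def supported_in_def by blast
  have "integrable lborel (\<lambda>x. indicator K x *\<^sub>R f x)"
    using assms K by (intro borel_integrable_compact) (auto simp: C0c_def intro: continuous_on_subset)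
  moreover have "(\<lambda>x. indicator K x *\<^sub>R f x) = f"
    using K by (intro ext) (auto simp: indicator_def)
  ultimately show ?thesis by simp
qed

lemma C0c_add: "f \<in> C0c \<Omega> \<Longrightarrow> g \<in> C0c \<Omega> \<Longrightarrow> (\<lambda>x. f x + g x) \<in> C0c \<Omega>"
  using supported_in_combine[of \<Omega> f g "\<lambda>x. f x + g x"]
  by (simp add: C0c_def continuous_on_add)

lemma C0c_weight_mult:
  assumes "open \<Omega>" "continuous_on \<Omega> h" "f \<in> C0c \<Omega>"
  shows "(\<lambda>x. h x * f x) \<in> C0c \<Omega>"
proof -
  obtain K where K: "compact K" "K \<subseteq> \<Omega>" "\<forall>x. x \<notin> K \<longrightarrow> f x = 0"
    using assms unfolding C0c_def supported_in_def by blast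
  have "continuous_on (\<Omega> \<union> -K) (\<lambda>x. h x * f x)"
  proof (rule continuous_on_open_Un)
    show "continuous_on \<Omega> (\<lambda>x. h x * f x)"
      using assms by (auto simp: C0c_def intro!: continuous_on_mult intro: continuous_on_subset)
    have "continuous_on (-K) (\<lambda>x. 0::real)" by simp
    then show "continuous_on (-K) (\<lambda>x. h x * f x)"
      by (rule continuous_on_eq) (use K in auto)
    show "open (-K)" using K(1) compact_imp_closed by blast
  qed (use assms in auto)
  moreover have "\<Omega> \<union> -K = UNIV" using K by auto
  ultimately show ?thesis
    using assms supported_in_vanish[of \<Omega> f "\<lambda>x. h x * f x"] by (simp add: C0c_def)
qed

lemma C0c_mult: "f \<in> C0c \<Omega> \<Longrightarrow> g \<in> C0c \<Omega> \<Longrightarrow> (\<lambda>x. f x * g x) \<in> C0c \<Omega>"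
  using supported_in_vanish[of \<Omega> f "\<lambda>x. f x * g x"]
  by (simp add: C0c_def continuous_on_mult)

lemma C0c_cmult: "f \<in> C0c \<Omega> \<Longrightarrow> (\<lambda>x. c * f x) \<in> C0c \<Omega>"
  using supported_in_vanish[of \<Omega> f "\<lambda>x. c * f x"]
  by (simp add: C0c_def continuous_on_mult)

lemma C0c_power2: "f \<in> C0c \<Omega> \<Longrightarrow> (\<lambda>x. (f x)\<^sup>2) \<in> C0c \<Omega>"
  unfolding power2_eq_square by (rule C0c_mult)

text \<open>A weight is only required to be \<open>C\<^sup>1\<close> on the open set \<open>\<Omega>\<close>, with gradient \<open>h'\<close>. It may blow up
  at the boundary: times a function with compact support in \<open>\<Omega>\<close> it still gives a \<open>C\<^sup>1\<close> function on
  the whole space.\<close>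

definition C1_weight ::
  "(real^'n::finite) set \<Rightarrow> (real^'n \<Rightarrow> real) \<Rightarrow> (real^'n \<Rightarrow> real^'n) \<Rightarrow> bool" where
  "C1_weight \<Omega> h h' \<longleftrightarrow>
    (\<forall>x\<in>\<Omega>. (h has_derivative (\<lambda>v. h' x \<bullet> v)) (at x)) \<and> continuous_on \<Omega> h'"

lemma C1_weight_continuous_on: "C1_weight \<Omega> h h' \<Longrightarrow> continuous_on \<Omega> h"
  unfolding C1_weight_def
  by (intro continuous_at_imp_continuous_on ballI has_derivative_continuous) auto

lemma
  assumes \<Omega>: "open \<Omega>" and h: "C1_weight \<Omega> h h'" and f: "f \<in> C1c \<Omega>"
  shows C1c_weight_mult: "(\<lambda>x. h x * f x) \<in> C1c \<Omega>"
    and partial_deriv_weight_mult: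
      "partial_deriv i (\<lambda>x. h x * f x) x = h' x $ i * f x + h x * partial_deriv i f x"
proof -
  obtain K where K: "compact K" "K \<subseteq> \<Omega>" "\<forall>x. x \<notin> K \<longrightarrow> f x = 0"
    using f unfolding C1c_def supported_in_def by blast
  have D: "((\<lambda>x. h x * f x) has_derivative
      (\<lambda>v. \<Sum>j\<in>UNIV. (h' x $ j * f x + h x * partial_deriv j f x) * v $ j)) (at x)" for x
  proof (cases "x \<in> K")
    case True
    then have "(h has_derivative (\<lambda>v. h' x \<bullet> v)) (at x)"
      using h K by (auto simp: C1_weight_def)
    moreover have "(f has_derivative (\<lambda>v. \<Sum>j\<in>UNIV. partial_deriv j f x * v $ j)) (at x)"
      using f by (intro has_derivative_partial_derivs) (simp add: C1c_def)
    ultimately have "((\<lambda>x. h x * f x) has_derivative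
      (\<lambda>v. h x * (\<Sum>j\<in>UNIV. partial_deriv j f x * v $ j) + (h' x \<bullet> v) * f x)) (at x)"
      by (rule has_derivative_mult)
    moreover have "(\<lambda>v. h x * (\<Sum>j\<in>UNIV. partial_deriv j f x * v $ j) + (h' x \<bullet> v) * f x)
      = (\<lambda>v. \<Sum>j\<in>UNIV. (h' x $ j * f x + h x * partial_deriv j f x) * v $ j)"
      by (rule ext)
        (simp add: inner_vec_def algebra_simps sum_distrib_left sum_distrib_right sum.distrib)
    ultimately show ?thesis by simp
  next
    case False
    have o: "open (-K)" using K(1) compact_imp_closed by blast
    have z: "((\<lambda>x. g x) has_derivative (\<lambda>v. 0)) (at x)"
      if "\<And>x. x \<notin> K \<Longrightarrow> g x = 0" for g :: "real^'a \<Rightarrow> real"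
      by (rule has_derivative_transform_within_open[of "\<lambda>x. 0" _ _ _ "-K"])
        (use o False that in auto)
    have "partial_deriv j f x = 0" for j
      using partial_deriv_outside_closed[OF compact_imp_closed[OF K(1)], of f x j] K False by simp
    then show ?thesis using z[of "\<lambda>x. h x * f x"] K False by simp
  qed
  have P: "partial_deriv i (\<lambda>x. h x * f x) x = h' x $ i * f x + h x * partial_deriv i f x" for i x
    using partial_deriv_eqI[OF D, of i x] by (simp add: axis_def if_distrib cong: if_cong)
  show "partial_deriv i (\<lambda>x. h x * f x) x = h' x $ i * f x + h x * partial_deriv i f x"
    by (rule P)
  have "continuous_on \<Omega> (\<lambda>x. h' x $ j)" for j
    using h by (intro continuous_intros) (simp add: C1_weight_def)
  then have "(\<lambda>x. h' x $ j * f x + h x * partial_deriv j f x) \<in> C0c \<Omega>" for j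
    using \<Omega> C1_weight_continuous_on[OF h] f
    by (intro C0c_add C0c_weight_mult C1c_imp_C0c partial_deriv_C0c)
  moreover have "(\<lambda>x. h x * f x) differentiable (at x)" for x
    using D unfolding differentiable_def by blast
  moreover have "supported_in \<Omega> (\<lambda>x. h x * f x)"
    using f supported_in_vanish[of \<Omega> f "\<lambda>x. h x * f x"] by (simp add: C1c_def)
  ultimately show "(\<lambda>x. h x * f x) \<in> C1c \<Omega>"
    using P unfolding C1c_def C0c_def by (simp add: P[THEN ext])
qed

lemma C1c_mult:
  assumes "f \<in> C1c \<Omega>" "g \<in> C1c \<Omega>"
  shows "(\<lambda>x. f x * g x) \<in> C1c \<Omega>"
proof -
  have d: "\<And>x. f differentiable (at x)" "\<And>x. g differentiable (at x)"
    using assms by (auto simp: C1c_def)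
  have "continuous_on UNIV (\<lambda>x. partial_deriv i f x * g x + f x * partial_deriv i g x)" for i
    using assms[THEN C1c_imp_C0c] assms[THEN partial_deriv_C0c, of i]
    by (auto simp: C0c_def intro!: continuous_intros)
  then show ?thesis
    using assms supported_in_vanish[of \<Omega> f "\<lambda>x. f x * g x"]
    by (simp add: C1c_def partial_deriv_mult[OF d, abs_def])
qed

text \<open>The integral of a partial derivative is the limit of integrals of difference quotients,
  and these vanish because Lebesgue measure is invariant under translations. The mean value theorem
  bounds the quotients uniformly on a fixed ball.\<close>

lemma integral_partial_deriv_eq_0:
  fixes f :: "real^'n::finite \<Rightarrow> real"
  assumes f: "f \<in> C1c \<Omega>"
  shows "(LINT x|lborel. partial_deriv i f x) = 0"
proof -
  define e where "e = (axis i 1 :: real^'n)"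
  obtain K where K: "compact K" "\<forall>x. x \<notin> K \<longrightarrow> f x = 0"
    using f unfolding C1c_def supported_in_def by blast
  obtain R where "\<forall>x\<in>K. norm x \<le> R"
    using compact_imp_bounded[OF K(1)] unfolding bounded_iff by blast
  then have R: "K \<subseteq> cball 0 R" by auto
  have d: "f differentiable (at x)" for x using f by (simp add: C1c_def)
  have cf: "continuous_on UNIV f" and cp: "continuous_on UNIV (partial_deriv i f)"
    using f C1c_imp_C0c[OF f] by (auto simp: C1c_def C0c_def)
  have if': "integrable lborel f" and ip: "integrable lborel (partial_deriv i f)"
    using C0c_integrable C1c_imp_C0c[OF f] partial_deriv_C0c[OF f] by blast+
  have "bounded (partial_deriv i f ` cball 0 (R + 1))"
    by (intro compact_imp_bounded compact_continuous_image continuous_on_subset[OF cp]) auto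
  then obtain M where "\<forall>y\<in>partial_deriv i f ` cball 0 (R + 1). norm y \<le> M"
    unfolding bounded_iff by blast
  then have M: "\<bar>partial_deriv i f x\<bar> \<le> M" if "norm x \<le> R + 1" for x
    using that by (auto simp: mem_cball)
  have p0: "partial_deriv i f x = 0" if "R < norm x" for x
  proof (rule partial_deriv_outside_closed[OF compact_imp_closed[OF K(1)]])
    show "x \<notin> K" using R that by auto
  qed (use K(2) in auto)
  define h where "h n = 1 / real (Suc n)" for n
  have h: "0 < h n" "h n \<le> 1" for n by (auto simp: h_def)
  define s where "s n x = (f (x + h n *\<^sub>R e) - f x) / h n" for n x
  have mv: "\<exists>t. 0 < t \<and> t < h n \<and> s n x = partial_deriv i f (x + t *\<^sub>R e)" for n x
  proof -
    have d1: "((\<lambda>t. f (x + t *\<^sub>R e)) has_real_derivative partial_deriv i f (x + t *\<^sub>R e)) (at t)" for t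
      unfolding e_def by (rule has_derivative_along_axis[OF d])
    obtain t where "0 < t" "t < h n"
      "f (x + h n *\<^sub>R e) - f (x + 0 *\<^sub>R e) = (h n - 0) * partial_deriv i f (x + t *\<^sub>R e)"
      using MVT2[OF h(1)[of n] d1] by blast
    then show ?thesis using h(1)[of n] by (auto simp: s_def)
  qed
  have tr: "(LINT x|lborel. f (x + v)) = (LINT x|lborel. f x)"
    and itr: "integrable lborel (\<lambda>x. f (x + v))" for v
  proof -
    have "(\<lambda>x. f (x + v)) = (\<lambda>x. f (v + x))" by (simp add: add.commute)
    moreover have "(LINT x|distr lborel borel ((+) v). f x) = (LINT x|lborel. f (v + x))"
      by (rule integral_distr) (use cf in \<open>auto intro: borel_measurable_continuous_onI\<close>)
    moreover have "integrable (distr lborel borel ((+) v)) f = integrable lborel (\<lambda>x. f (v + x))"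
      by (rule integrable_distr_eq) (use cf in \<open>auto intro: borel_measurable_continuous_onI\<close>)
    ultimately show "(LINT x|lborel. f (x + v)) = (LINT x|lborel. f x)"
      "integrable lborel (\<lambda>x. f (x + v))"
      using if' by (simp_all add: lborel_distr_plus)
  qed
  have s0: "(LINT x|lborel. s n x) = 0" for n
    unfolding s_def using itr[of "h n *\<^sub>R e"] if' by (simp add: tr)
  have "(\<lambda>n. LINT x|lborel. s n x) \<longlonglongrightarrow> (LINT x|lborel. partial_deriv i f x)"
  proof (rule integral_dominated_convergence[where w = "\<lambda>x. indicator (cball 0 (R + 1)) x *\<^sub>R \<bar>M\<bar>"])
    show "partial_deriv i f \<in> borel_measurable lborel" using ip by auto
    show "s n \<in> borel_measurable lborel" for n
      unfolding s_def using itr[of "h n *\<^sub>R e"] if' by (intro borel_measurable_divide borel_measurable_diff) auto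
    show "integrable lborel (\<lambda>x::real^'n. indicator (cball 0 (R + 1)) x *\<^sub>R \<bar>M\<bar>)"
      by (rule borel_integrable_compact) auto
    show "AE x in lborel. (\<lambda>n. s n x) \<longlonglongrightarrow> partial_deriv i f x"
    proof (rule AE_I2)
      fix x
      have "\<forall>n. \<exists>t. 0 < t \<and> t < h n \<and> s n x = partial_deriv i f (x + t *\<^sub>R e)"
        using mv by blast
      then obtain t where t: "\<And>n. 0 < t n" "\<And>n. t n < h n"
        "\<And>n. s n x = partial_deriv i f (x + t n *\<^sub>R e)" by metis
      have "h \<longlonglongrightarrow> 0" unfolding h_def by (rule LIMSEQ_Suc[OF lim_1_over_n])
      then have "t \<longlonglongrightarrow> 0"
        by (rule real_tendsto_sandwich[OF _ _ tendsto_const, rotated 2])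
          (use t(1,2) in \<open>auto intro!: always_eventually less_imp_le\<close>)
      then have "(\<lambda>n. x + t n *\<^sub>R e) \<longlonglongrightarrow> x + 0 *\<^sub>R e" by (intro tendsto_intros)
      then have "(\<lambda>n. x + t n *\<^sub>R e) \<longlonglongrightarrow> x" by simp
      moreover have "isCont (partial_deriv i f) x"
        using cp by (simp add: continuous_on_eq_continuous_at)
      ultimately show "(\<lambda>n. s n x) \<longlonglongrightarrow> partial_deriv i f x"
        unfolding t(3) using isCont_tendsto_compose by blast
    qed
    show "AE x in lborel. norm (s n x) \<le> indicator (cball 0 (R + 1)) x *\<^sub>R \<bar>M\<bar>" for n
    proof (rule AE_I2)
      fix x
      obtain t where t: "0 < t" "t < h n" "s n x = partial_deriv i f (x + t *\<^sub>R e)"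
        using mv by blast
      have n: "norm (t *\<^sub>R e) \<le> 1" using t h[of n] by (simp add: e_def)
      show "norm (s n x) \<le> indicator (cball 0 (R + 1)) x *\<^sub>R \<bar>M\<bar>"
      proof (cases "norm x \<le> R + 1")
        case True
        have "\<bar>partial_deriv i f (x + t *\<^sub>R e)\<bar> \<le> \<bar>M\<bar>"
          using M[of "x + t *\<^sub>R e"] p0[of "x + t *\<^sub>R e"] by fastforce
        then show ?thesis using True t by (simp add: indicator_def)
      next
        case False
        then have "R < norm (x + t *\<^sub>R e)"
          using n norm_triangle_ineq2[of x "- (t *\<^sub>R e)"] by simp
        then show ?thesis using t p0 by simp
      qed
    qed
  qed
  then show ?thesis unfolding s0 using LIMSEQ_unique tendsto_const by blast
qed

lemma integral_by_parts:
  assumes "f \<in> C1c \<Omega>" "g \<in> C1c \<Omega>"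
  shows "(LINT x|lborel. f x * partial_deriv i g x) = - (LINT x|lborel. partial_deriv i f x * g x)"
proof -
  have d: "\<And>x. f differentiable (at x)" "\<And>x. g differentiable (at x)"
    using assms by (auto simp: C1c_def)
  have "0 = (LINT x|lborel. partial_deriv i f x * g x + f x * partial_deriv i g x)"
    using integral_partial_deriv_eq_0[OF C1c_mult[OF assms], of i]
    by (simp add: partial_deriv_mult[OF d])
  also have "\<dots> = (LINT x|lborel. partial_deriv i f x * g x) + (LINT x|lborel. f x * partial_deriv i g x)"
    using assms
    by (intro Bochner_Integration.integral_add C0c_integrable[of _ \<Omega>] C0c_mult C1c_imp_C0c partial_deriv_C0c)
  finally show ?thesis by simp
qed

section \<open>Radial and angular derivatives of test functions\<close>

text \<open>For \<open>f = |x| w\<close> the number \<open>wint (f\<^sup>2)\<close> is \<open>\<integral> w\<^sup>2 dt d\<theta>\<close> with \<open>t = ln |x|\<close>.\<close>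

definition wint :: "(real^2 \<Rightarrow> real) \<Rightarrow> real" where
  "wint F = (LINT x|lborel. F x / (norm x) ^ 4)"

text \<open>The derivatives \<open>\<partial>\<^sub>t\<close> and \<open>\<partial>\<^sub>\<theta>\<close> of \<open>w = f / |x|\<close>, multiplied by \<open>|x|\<close> again. The summand \<open>- f\<close>
  comes from differentiating the factor \<open>1 / |x|\<close>.\<close>

definition radial_D :: "(real^2 \<Rightarrow> real) \<Rightarrow> real^2 \<Rightarrow> real" where
  "radial_D f x = x $ 1 * partial_deriv 1 f x + x $ 2 * partial_deriv 2 f x - f x"

definition angular_D :: "(real^2 \<Rightarrow> real) \<Rightarrow> real^2 \<Rightarrow> real" where
  "angular_D f x = x $ 1 * partial_deriv 2 f x - x $ 2 * partial_deriv 1 f x"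

lemma radial_D_test: "f \<in> test_functions \<Omega> \<Longrightarrow> radial_D f \<in> test_functions \<Omega>"
  unfolding radial_D_def[abs_def]
  by (intro test_add test_diff test_mult smooth_coord test_partial_deriv)

lemma angular_D_test: "f \<in> test_functions \<Omega> \<Longrightarrow> angular_D f \<in> test_functions \<Omega>"
  unfolding angular_D_def[abs_def]
  by (intro test_add test_diff test_mult smooth_coord test_partial_deriv)

lemma partial_deriv_coord_mult:
  fixes g :: "real^'n::finite \<Rightarrow> real"
  assumes "smooth g"
  shows "partial_deriv i (\<lambda>x. x $ j * g x) x = (if i = j then g x else 0) + x $ j * partial_deriv i g x"
  using partial_deriv_mult[OF smooth_differentiable[OF smooth_coord[of j]] smooth_differentiable[OF assms], where i=i and x=x]
  by (simp add: partial_deriv_coord)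

lemma
  assumes "smooth f"
  shows partial_deriv_radial_D: "partial_deriv i (radial_D f) x =
      (if i = 1 then partial_deriv 1 f x else 0) + x $ 1 * partial_deriv i (partial_deriv 1 f) x
      + ((if i = 2 then partial_deriv 2 f x else 0) + x $ 2 * partial_deriv i (partial_deriv 2 f) x)
      - partial_deriv i f x"
    and partial_deriv_angular_D: "partial_deriv i (angular_D f) x =
      (if i = 1 then partial_deriv 2 f x else 0) + x $ 1 * partial_deriv i (partial_deriv 2 f) x
      - ((if i = 2 then partial_deriv 1 f x else 0) + x $ 2 * partial_deriv i (partial_deriv 1 f) x)"
proof -
  note s = smooth_partial_deriv[OF assms] assms
  have sm: "smooth (\<lambda>x. x $ j * partial_deriv i f x)" for i j
    by (intro smooth_mult smooth_coord s)
  note d = smooth_differentiable[OF sm] smooth_differentiable[OF smooth_add[OF sm sm]]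
    smooth_differentiable[OF assms]
  show "partial_deriv i (radial_D f) x =
      (if i = 1 then partial_deriv 1 f x else 0) + x $ 1 * partial_deriv i (partial_deriv 1 f) x
      + ((if i = 2 then partial_deriv 2 f x else 0) + x $ 2 * partial_deriv i (partial_deriv 2 f) x)
      - partial_deriv i f x"
    unfolding radial_D_def[abs_def]
    by (simp add: partial_deriv_diff partial_deriv_add partial_deriv_coord_mult d s)
  show "partial_deriv i (angular_D f) x =
      (if i = 1 then partial_deriv 2 f x else 0) + x $ 1 * partial_deriv i (partial_deriv 2 f) x
      - ((if i = 2 then partial_deriv 1 f x else 0) + x $ 2 * partial_deriv i (partial_deriv 1 f) x)"
    unfolding angular_D_def[abs_def]
    by (simp add: partial_deriv_diff partial_deriv_coord_mult d s)
qed

lemma radial_angular_commute: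
  assumes "smooth f"
  shows "radial_D (angular_D f) = angular_D (radial_D f)"
proof
  fix x
  have c: "partial_deriv 2 (partial_deriv 1 f) = partial_deriv 1 (partial_deriv 2 f)"
    by (rule smooth_partial_deriv_commute[OF assms])
  show "radial_D (angular_D f) x = angular_D (radial_D f) x"
    unfolding radial_D_def[of "angular_D f"] angular_D_def[of "radial_D f"]
      partial_deriv_radial_D[OF assms] partial_deriv_angular_D[OF assms] c
    by (simp add: radial_D_def angular_D_def algebra_simps)
qed

text \<open>This is \<open>|x|\<^sup>2 \<Delta> = (x \<bullet> \<nabla>)\<^sup>2 + \<partial>\<^sub>\<theta>\<^sup>2\<close>, rewritten with \<open>x \<bullet> \<nabla> = T + 1\<close> for the radial operator
  \<open>T\<close>.\<close>

lemma laplacian_radial_angular: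
  assumes "smooth f"
  shows "radial_D (radial_D f) x + angular_D (angular_D f) x + 2 * radial_D f x + f x
    = (norm x)\<^sup>2 * (partial_deriv 1 (partial_deriv 1 f) x + partial_deriv 2 (partial_deriv 2 f) x)"
proof -
  have c: "partial_deriv 2 (partial_deriv 1 f) = partial_deriv 1 (partial_deriv 2 f)"
    by (rule smooth_partial_deriv_commute[OF assms])
  have n: "(norm x)\<^sup>2 = x $ 1 * x $ 1 + x $ 2 * x $ 2"
    by (simp add: power2_norm_eq_inner inner_vec_def sum_2)
  show ?thesis
    unfolding radial_D_def[of "radial_D f"] angular_D_def[of "angular_D f"] n
      partial_deriv_radial_D[OF assms] partial_deriv_angular_D[OF assms] c
    by (simp add: radial_D_def angular_D_def algebra_simps)
qed

locale punctured_domain =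
  fixes \<Omega> :: "(real^2) set"
  assumes open_dom: "open \<Omega>" and zero_notin: "0 \<notin> \<Omega>"
begin

text \<open>Integrations by parts are recorded as integrands of vanishing integral. They form a vector space,
  so that an identity between integrals follows from a pointwise polynomial identity modulo such
  integrands.\<close>

definition null :: "(real^2 \<Rightarrow> real) \<Rightarrow> bool" where
  "null F \<longleftrightarrow> F \<in> C0c \<Omega> \<and> wint F = 0"

lemma wint_integrable: "F \<in> C0c \<Omega> \<Longrightarrow> integrable lborel (\<lambda>x. F x / (norm x) ^ 4)"
proof -
  assume F: "F \<in> C0c \<Omega>"
  have "continuous_on \<Omega> (\<lambda>x. 1 / (norm x) ^ 4)"
    using zero_notin by (intro continuous_intros) auto
  from C0c_integrable[OF C0c_weight_mult[OF open_dom this F]] show ?thesis by simp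
qed

lemma wint_add: "F \<in> C0c \<Omega> \<Longrightarrow> G \<in> C0c \<Omega> \<Longrightarrow> wint (\<lambda>x. F x + G x) = wint F + wint G"
  unfolding wint_def by (simp add: add_divide_distrib wint_integrable)

lemma wint_cmult: "wint (\<lambda>x. c * F x) = c * wint F"
  unfolding wint_def by (simp flip: times_divide_eq_right)

lemma wint_mono:
  "F \<in> C0c \<Omega> \<Longrightarrow> G \<in> C0c \<Omega> \<Longrightarrow> (\<And>x. F x \<le> G x) \<Longrightarrow> wint F \<le> wint G"
  unfolding wint_def by (intro integral_mono wint_integrable divide_right_mono) auto

lemma null_add: "null F \<Longrightarrow> null G \<Longrightarrow> null (\<lambda>x. F x + G x)"
  by (simp add: null_def C0c_add wint_add)

lemma null_cmult: "null F \<Longrightarrow> null (\<lambda>x. c * F x)"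
  by (simp add: null_def C0c_cmult wint_cmult)

lemma wint_le_null:
  assumes "F \<in> C0c \<Omega>" "G \<in> C0c \<Omega>" "null N" "\<And>x. F x + N x \<le> G x"
  shows "wint F \<le> wint G"
  using wint_mono[OF C0c_add[of F \<Omega> N] assms(2)] assms by (simp add: null_def wint_add)

lemma weight_coord:
  "C1_weight \<Omega> (\<lambda>x. x $ i / (norm x) ^ 4)
    (\<lambda>x. (1 / (norm x) ^ 4) *\<^sub>R axis i 1 - (4 * x $ i / (norm x) ^ 6) *\<^sub>R x)"
proof -
  have n4: "(norm x) ^ 4 = (x \<bullet> x)\<^sup>2" "(norm x) ^ 6 = (x \<bullet> x) ^ 3" for x :: "real^2"
    by (simp_all flip: power2_norm_eq_inner power_mult)
  have "((\<lambda>x. x $ i / (x \<bullet> x)\<^sup>2) has_derivative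
     (\<lambda>v. ((1 / (x \<bullet> x)\<^sup>2) *\<^sub>R axis i 1 - (4 * x $ i / (x \<bullet> x) ^ 3) *\<^sub>R x) \<bullet> v)) (at x)"
    if "x \<in> \<Omega>" for x
  proof -
    have x: "x \<bullet> x \<noteq> 0" using that zero_notin by auto
    have c: "((\<lambda>x::real^2. x $ i) has_derivative (\<lambda>v. v $ i)) (at x)"
      by (rule bounded_linear_imp_has_derivative[OF bounded_linear_vec_nth])
    have q: "((\<lambda>x. (x \<bullet> x)\<^sup>2) has_derivative (\<lambda>v. 4 * (x \<bullet> x) * (x \<bullet> v))) (at x)"
      by (auto intro!: derivative_eq_intros simp: inner_commute fun_eq_iff)
    have e: "(v $ i * (x \<bullet> x)\<^sup>2 - x $ i * (4 * (x \<bullet> x) * (x \<bullet> v))) / ((x \<bullet> x)\<^sup>2 * (x \<bullet> x)\<^sup>2)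
      = ((1 / (x \<bullet> x)\<^sup>2) *\<^sub>R axis i 1 - (4 * x $ i / (x \<bullet> x) ^ 3) *\<^sub>R x) \<bullet> v" for v
      using x by (simp add: inner_axis' inner_diff_left power2_eq_square power3_eq_cube field_simps)
    show ?thesis
      by (rule has_derivative_eq_rhs[OF has_derivative_divide'[OF c q]]) (use x e in auto)
  qed
  moreover have "continuous_on \<Omega> (\<lambda>x. (1 / (x \<bullet> x)\<^sup>2) *\<^sub>R axis i 1 - (4 * x $ i / (x \<bullet> x) ^ 3) *\<^sub>R x)"
    using zero_notin by (intro continuous_intros) auto
  ultimately show ?thesis unfolding C1_weight_def n4 by blast
qed

text \<open>Both integrands, divided by \<open>|x|\<^sup>4\<close>, are divergences: of \<open>x G / |x|\<^sup>4\<close>, where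
  \<open>div (x / |x|\<^sup>4) = - 2 / |x|\<^sup>4\<close> in the plane, and of \<open>x\<^sup>\<bottom> G / |x|\<^sup>4\<close> with the rotated field \<open>x\<^sup>\<bottom>\<close>,
  where \<open>div (x\<^sup>\<bottom> / |x|\<^sup>4) = 0\<close>.\<close>

lemma
  assumes G: "G \<in> C1c \<Omega>"
  shows null_radial: "null (\<lambda>x. x $ 1 * partial_deriv 1 G x + x $ 2 * partial_deriv 2 G x - 2 * G x)"
    and null_angular: "null (angular_D G)"
proof -
  define V where "V i x = (x::real^2) $ i / (norm x) ^ 4" for i x
  note W = weight_coord[folded V_def]
  define P where "P i j = partial_deriv j (\<lambda>x. V i x * G x)" for i j
  have V1: "(\<lambda>x. V i x * G x) \<in> C1c \<Omega>" for i
    by (rule C1c_weight_mult[OF open_dom W G])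
  have P0: "(LINT x|lborel. P i j x) = 0" and PI: "integrable lborel (P i j)" for i j
    unfolding P_def
    by (rule integral_partial_deriv_eq_0[OF V1], rule C0c_integrable[OF partial_deriv_C0c[OF V1]])
  have P: "P i j x = ((if i = j then 1 / norm x ^ 4 else 0) - (4 * x $ i * x $ j / (norm x) ^ 6)) * G x
     + x $ i / norm x ^ 4 * partial_deriv j G x" for i j x
    unfolding P_def partial_deriv_weight_mult[OF open_dom W G]
    by (simp add: V_def axis_def)
  have c: "(\<lambda>x. x $ i * partial_deriv j G x) \<in> C0c \<Omega>" for i j
    by (intro C0c_weight_mult open_dom continuous_intros partial_deriv_C0c G)
  have c1: "(\<lambda>x. x $ 1 * partial_deriv 1 G x + x $ 2 * partial_deriv 2 G x - 2 * G x) \<in> C0c \<Omega>"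
    using C0c_add[OF C0c_add[OF c[of 1 1] c[of 2 2]] C0c_cmult[OF C1c_imp_C0c[OF G], of "-2"]] by simp
  have "wint (\<lambda>x. x $ 1 * partial_deriv 1 G x + x $ 2 * partial_deriv 2 G x - 2 * G x)
      = (LINT x|lborel. P 1 1 x + P 2 2 x)"
    unfolding wint_def
  proof (rule Bochner_Integration.integral_cong)
    fix x :: "real^2"
    show "(x $ 1 * partial_deriv 1 G x + x $ 2 * partial_deriv 2 G x - 2 * G x) / norm x ^ 4
        = P 1 1 x + P 2 2 x"
    proof (cases "x = 0")
      case False
      have "4 * (x $ 1 * x $ 1) / norm x ^ 6 + 4 * (x $ 2 * x $ 2) / norm x ^ 6 = 4 * (norm x)\<^sup>2 / norm x ^ 6"
        by (simp add: power2_norm_eq_inner inner_vec_def sum_2 add_divide_distrib)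
      also have "\<dots> = 4 / norm x ^ 4"
        using False by (simp add: field_simps flip: power_add)
      finally have "(4 * (x $ 1 * x $ 1) / norm x ^ 6 + 4 * (x $ 2 * x $ 2) / norm x ^ 6) * G x
        = 4 / norm x ^ 4 * G x" by simp
      then show ?thesis unfolding P by (simp add: algebra_simps diff_divide_distrib add_divide_distrib)
    qed (simp add: P)
  qed simp
  then show "null (\<lambda>x. x $ 1 * partial_deriv 1 G x + x $ 2 * partial_deriv 2 G x - 2 * G x)"
    using c1 P0[of 1 1] P0[of 2 2] PI[of 1 1] PI[of 2 2] unfolding null_def by simp
  have "wint (angular_D G) = (LINT x|lborel. P 1 2 x - P 2 1 x)"
    unfolding wint_def
    by (rule Bochner_Integration.integral_cong)
      (simp_all add: P angular_D_def algebra_simps diff_divide_distrib)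
  moreover have "angular_D G \<in> C0c \<Omega>"
    using C0c_add[OF c[of 1 2] C0c_cmult[OF c[of 2 1], of "-1"]] by (simp add: angular_D_def[abs_def])
  ultimately show "null (angular_D G)"
    using P0[of 1 2] P0[of 2 1] PI[of 1 2] PI[of 2 1] unfolding null_def by simp
qed

text \<open>The product rule for the radial operator, integrated: \<open>h' x \<bullet> x\<close> is the derivative of the weight
  with respect to \<open>ln |x|\<close>. For constant weights it says that the radial operator is
  skew-symmetric.\<close>

lemma null_radial_product:
  assumes F: "F \<in> test_functions \<Omega>" and G: "G \<in> test_functions \<Omega>" and h: "C1_weight \<Omega> h h'"
  shows "null (\<lambda>x. (h' x \<bullet> x) * (F x * G x) + h x * (radial_D F x * G x + F x * radial_D G x))"
proof -
  have d: "\<And>x. F differentiable (at x)" "\<And>x. G differentiable (at x)"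
    using F G by (auto intro: smooth_differentiable dest: test_smooth)
  have FG: "(\<lambda>x. F x * G x) \<in> C1c \<Omega>" by (intro C1c_mult test_imp_C1c F G)
  have "(\<lambda>x. (h' x \<bullet> x) * (F x * G x) + h x * (radial_D F x * G x + F x * radial_D G x))
    = (\<lambda>x. x $ 1 * partial_deriv 1 (\<lambda>x. h x * (F x * G x)) x
        + x $ 2 * partial_deriv 2 (\<lambda>x. h x * (F x * G x)) x - 2 * (h x * (F x * G x)))"
    unfolding partial_deriv_weight_mult[OF open_dom h FG] partial_deriv_mult[OF d] radial_D_def
    by (rule ext) (simp add: inner_vec_def sum_2 algebra_simps)
  then show ?thesis
    using null_radial[OF C1c_weight_mult[OF open_dom h FG]] by simp
qed

lemma null_radial_skew:
  assumes F: "F \<in> test_functions \<Omega>" and G: "G \<in> test_functions \<Omega>"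
  shows "null (\<lambda>x. radial_D F x * G x + F x * radial_D G x)"
proof -
  have "C1_weight \<Omega> (\<lambda>x. 1) (\<lambda>x. 0)" by (simp add: C1_weight_def)
  from null_radial_product[OF F G this] show ?thesis by simp
qed

lemma null_angular_skew:
  assumes F: "F \<in> test_functions \<Omega>" and G: "G \<in> test_functions \<Omega>"
  shows "null (\<lambda>x. angular_D F x * G x + F x * angular_D G x)"
proof -
  have d: "\<And>x. F differentiable (at x)" "\<And>x. G differentiable (at x)"
    using F G by (auto intro: smooth_differentiable dest: test_smooth)
  have FG: "(\<lambda>x. F x * G x) \<in> C1c \<Omega>" by (intro C1c_mult test_imp_C1c F G)
  have "(\<lambda>x. angular_D F x * G x + F x * angular_D G x) = angular_D (\<lambda>x. F x * G x)"
    unfolding angular_D_def[abs_def] partial_deriv_mult[OF d]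
    by (rule ext) (simp add: algebra_simps)
  then show ?thesis using null_angular[OF FG] by simp
qed

text \<open>With \<open>T\<close>, \<open>S\<close> for the radial and angular operator, the mixed terms are evaluated by
  skew-symmetry and \<open>T S = S T\<close>: \<open>\<langle>T\<^sup>2 f, T f\<rangle>\<close>, \<open>\<langle>T f, f\<rangle>\<close> and \<open>\<langle>T f, S\<^sup>2 f\<rangle>\<close> vanish, while
  \<open>\<langle>T\<^sup>2 f, f\<rangle> = - \<parallel>T f\<parallel>\<^sup>2\<close>, \<open>\<langle>f, S\<^sup>2 f\<rangle> = - \<parallel>S f\<parallel>\<^sup>2\<close> and \<open>\<langle>T\<^sup>2 f, S\<^sup>2 f\<rangle> = \<parallel>T S f\<parallel>\<^sup>2\<close>.\<close>

lemma energy_identity: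
  fixes m :: real
  assumes f: "f \<in> test_functions \<Omega>"
  shows "wint (\<lambda>x. (radial_D (radial_D f) x + 2 * m * radial_D f x + m\<^sup>2 * f x + angular_D (angular_D f) x)\<^sup>2)
    = wint (\<lambda>x. (radial_D (radial_D f) x)\<^sup>2) + 2 * m\<^sup>2 * wint (\<lambda>x. (radial_D f x)\<^sup>2)
      + m ^ 4 * wint (\<lambda>x. (f x)\<^sup>2) + wint (\<lambda>x. (angular_D (angular_D f) x)\<^sup>2)
      + 2 * wint (\<lambda>x. (radial_D (angular_D f) x)\<^sup>2) - 2 * m\<^sup>2 * wint (\<lambda>x. (angular_D f x)\<^sup>2)"
proof -
  define g where "g = radial_D f"
  define h where "h = radial_D g"
  define s where "s = angular_D f"
  define r where "r = angular_D s"
  define k where "k = radial_D s"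
  have t: "g \<in> test_functions \<Omega>" "h \<in> test_functions \<Omega>" "s \<in> test_functions \<Omega>"
    "r \<in> test_functions \<Omega>" "k \<in> test_functions \<Omega>"
    unfolding k_def r_def s_def h_def g_def by (intro radial_D_test angular_D_test f)+
  have sg: "angular_D g = k"
    unfolding k_def s_def g_def by (rule radial_angular_commute[OF test_smooth[OF f], symmetric])
  have rk: "radial_D r = angular_D k"
    unfolding r_def k_def by (rule radial_angular_commute[OF test_smooth[OF t(3)]])
  define n1 where "n1 x = h x * g x + g x * h x" for x
  define n2 where "n2 x = h x * f x + g x * g x" for x
  define n3 where "n3 x = g x * f x + f x * g x" for x
  define n4 where "n4 x = k x * s x + g x * r x" for x
  define n5 where "n5 x = k x * s x + s x * k x" for x
  define n6 where "n6 x = s x * s x + f x * r x" for x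
  define n7 where "n7 x = h x * r x + g x * angular_D k x" for x
  define n8 where "n8 x = k x * k x + g x * angular_D k x" for x
  note n_defs = n1_def n2_def n3_def n4_def n5_def n6_def n7_def n8_def
  have n: "null n1" "null n2" "null n3" "null n4" "null n5" "null n6" "null n7" "null n8"
    using null_radial_skew[OF t(1) t(1)] null_radial_skew[OF t(1) f] null_radial_skew[OF f f]
      null_angular_skew[OF t(1) t(3)] null_radial_skew[OF t(3) t(3)] null_angular_skew[OF f t(3)]
      null_radial_skew[OF t(1) t(4)] null_angular_skew[OF t(1) t(5)]
    unfolding g_def[symmetric] h_def[symmetric] s_def[symmetric] r_def[symmetric]
      k_def[symmetric] sg rk n_defs[abs_def] .
  \<comment> \<open>the mixed terms of the square, up to the squares that they leave behind\<close>
  define N where "N x = 2 * m * n1 x + (2 * m\<^sup>2 * n2 x + (2 * m ^ 3 * n3 x + (4 * m * n4 x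
    + (- (2 * m) * n5 x + (2 * m\<^sup>2 * n6 x + (2 * n7 x + (- 2) * n8 x))))))" for x
  have "null N"
    unfolding N_def[abs_def] by (intro null_add null_cmult n)
  then have N: "N \<in> C0c \<Omega>" "wint N = 0" by (simp_all add: null_def)
  define sq where "sq f x = (f x)\<^sup>2" for f :: "real^2 \<Rightarrow> real" and x
  have c: "sq h \<in> C0c \<Omega>" "sq g \<in> C0c \<Omega>" "sq f \<in> C0c \<Omega>" "sq r \<in> C0c \<Omega>" "sq k \<in> C0c \<Omega>" "sq s \<in> C0c \<Omega>"
    unfolding sq_def[abs_def] by (intro C0c_power2 test_imp_C0c f t)+
  have "(h x + 2 * m * g x + m\<^sup>2 * f x + r x)\<^sup>2 = sq h x + (2 * m\<^sup>2 * sq g x + (m ^ 4 * sq f x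
      + (sq r x + (2 * sq k x + (- (2 * m\<^sup>2) * sq s x + N x)))))" for x
    unfolding N_def n_defs sq_def by algebra
  then have "wint (\<lambda>x. (h x + 2 * m * g x + m\<^sup>2 * f x + r x)\<^sup>2) = wint (sq h) + (2 * m\<^sup>2 * wint (sq g)
      + (m ^ 4 * wint (sq f) + (wint (sq r) + (2 * wint (sq k) + (- (2 * m\<^sup>2) * wint (sq s) + wint N)))))"
    by (simp only: wint_add wint_cmult C0c_add C0c_cmult c N(1))
  then show ?thesis
    unfolding N(2) by (simp add: k_def r_def s_def h_def g_def sq_def[abs_def])
qed


lemma test_outside: "f \<in> test_functions \<Omega> \<Longrightarrow> x \<notin> \<Omega> \<Longrightarrow> f x = 0"
  unfolding test_functions_iff supported_in_def by blast

text \<open>Completing the square with a solution of the Riccati equation \<open>\<partial>\<^sub>t c + c\<^sup>2 = - \<kappa>\<close>: up to a null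
  integrand, \<open>(T f - c f)\<^sup>2\<close> equals \<open>(T f)\<^sup>2 - \<kappa> f\<^sup>2\<close>.\<close>

lemma radial_poincare:
  assumes f: "f \<in> test_functions \<Omega>" and c: "C1_weight \<Omega> c c'"
    and eq: "\<And>x. x \<in> \<Omega> \<Longrightarrow> c' x \<bullet> x = - \<kappa> - (c x)\<^sup>2"
  shows "\<kappa> * wint (\<lambda>x. (f x)\<^sup>2) \<le> wint (\<lambda>x. (radial_D f x)\<^sup>2)"
proof -
  define g where "g = radial_D f"
  have g: "g \<in> test_functions \<Omega>" unfolding g_def by (rule radial_D_test[OF f])
  define N where "N x = (c' x \<bullet> x) * (f x * f x) + c x * (g x * f x + f x * g x)" for x
  have N: "null N"
    unfolding N_def[abs_def] g_def by (rule null_radial_product[OF f f c])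
  have "wint (\<lambda>x. \<kappa> * (f x)\<^sup>2) \<le> wint (\<lambda>x. (g x)\<^sup>2)"
  proof (rule wint_le_null[OF _ _ N])
    show "\<kappa> * (f x)\<^sup>2 + N x \<le> (g x)\<^sup>2" for x
    proof (cases "x \<in> \<Omega>")
      case True
      have "(g x)\<^sup>2 - (\<kappa> * (f x)\<^sup>2 + N x) = (g x - c x * f x)\<^sup>2"
        unfolding N_def eq[OF True] by algebra
      then show ?thesis by (metis diff_ge_0_iff_ge zero_le_power2)
    next
      case False
      then show ?thesis using test_outside[OF f] test_outside[OF g] by (simp add: N_def)
    qed
  qed (intro C0c_cmult C0c_power2 test_imp_C0c f g)+
  then show ?thesis by (simp add: wint_cmult g_def)
qed

text \<open>The second order analogue: if the weights solve the stated system of Riccati type, then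
  \<open>(T\<^sup>2 f - P T f - Q f)\<^sup>2\<close> equals \<open>(T\<^sup>2 f)\<^sup>2 - \<kappa> (T f)\<^sup>2\<close> up to a null integrand. The coefficient of
  \<open>f T f\<close> left by the expansion is \<open>2 (\<partial>\<^sub>t Q + P Q) = 2 R\<close>, and integrating it by parts
  cancels the term \<open>Q\<^sup>2 f\<^sup>2\<close>.\<close>

lemma radial_poincare_second_order:
  assumes f: "f \<in> test_functions \<Omega>"
    and P: "C1_weight \<Omega> P P'" and Q: "C1_weight \<Omega> Q Q'" and R: "C1_weight \<Omega> R R'"
    and P': "\<And>x. x \<in> \<Omega> \<Longrightarrow> P' x \<bullet> x = - \<kappa> - 2 * Q x - (P x)\<^sup>2"
    and Q': "\<And>x. x \<in> \<Omega> \<Longrightarrow> Q' x \<bullet> x = R x - P x * Q x"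
    and R': "\<And>x. x \<in> \<Omega> \<Longrightarrow> R' x \<bullet> x = (Q x)\<^sup>2"
  shows "\<kappa> * wint (\<lambda>x. (radial_D f x)\<^sup>2) \<le> wint (\<lambda>x. (radial_D (radial_D f) x)\<^sup>2)"
proof -
  define g where "g = radial_D f"
  define h where "h = radial_D g"
  have g: "g \<in> test_functions \<Omega>" unfolding g_def by (rule radial_D_test[OF f])
  have h: "h \<in> test_functions \<Omega>" unfolding h_def by (rule radial_D_test[OF g])
  define N1 where "N1 x = (P' x \<bullet> x) * (g x * g x) + P x * (h x * g x + g x * h x)" for x
  define N2 where "N2 x = (Q' x \<bullet> x) * (f x * g x) + Q x * (g x * g x + f x * h x)" for x
  define N3 where "N3 x = (R' x \<bullet> x) * (f x * f x) + R x * (g x * f x + f x * g x)" for x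
  have n: "null N1" "null N2" "null N3"
    using null_radial_product[OF g g P] null_radial_product[OF f g Q] null_radial_product[OF f f R]
    unfolding N1_def[abs_def] N2_def[abs_def] N3_def[abs_def] g_def[symmetric] h_def[symmetric] .
  have N: "null (\<lambda>x. N1 x + (2 * N2 x + (- 1) * N3 x))"
    by (intro null_add null_cmult n)
  have "wint (\<lambda>x. \<kappa> * (g x)\<^sup>2) \<le> wint (\<lambda>x. (h x)\<^sup>2)"
  proof (rule wint_le_null[OF _ _ N])
    show "\<kappa> * (g x)\<^sup>2 + (N1 x + (2 * N2 x + (- 1) * N3 x)) \<le> (h x)\<^sup>2" for x
    proof (cases "x \<in> \<Omega>")
      case True
      have "(h x)\<^sup>2 - (\<kappa> * (g x)\<^sup>2 + (N1 x + (2 * N2 x + (- 1) * N3 x))) = (h x - P x * g x - Q x * f x)\<^sup>2"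
        unfolding N1_def N2_def N3_def P'[OF True] Q'[OF True] R'[OF True] by algebra
      then show ?thesis by (metis diff_ge_0_iff_ge zero_le_power2)
    next
      case False
      then show ?thesis using test_outside[OF f] test_outside[OF g] test_outside[OF h] by (simp add: N1_def N2_def N3_def)
    qed
  qed (intro C0c_cmult C0c_power2 test_imp_C0c g h)+
  then show ?thesis by (simp add: wint_cmult g_def h_def)
qed

text \<open>The square \<open>\<parallel>S\<^sup>2 f + (m\<^sup>2 - \<kappa>) f\<parallel>\<^sup>2\<close> controls \<open>\<parallel>S\<^sup>2 f\<parallel>\<^sup>2 - 2 (m\<^sup>2 - \<kappa>) \<parallel>S f\<parallel>\<^sup>2\<close> from below. The shift by \<open>\<kappa>\<close>
  is chosen so that the remainder \<open>- 2 \<kappa> \<parallel>S f\<parallel>\<^sup>2\<close> is exactly what \<open>2 \<parallel>T S f\<parallel>\<^sup>2\<close> compensates. It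
  costs \<open>(m\<^sup>2 - \<kappa>)\<^sup>2 \<parallel>f\<parallel>\<^sup>2 = (m\<^sup>4 - 2 m\<^sup>2 \<kappa> + \<kappa>\<^sup>2) \<parallel>f\<parallel>\<^sup>2\<close>; the loss of \<open>\<kappa>\<^sup>2\<close> is made up for by
  \<open>\<parallel>T\<^sup>2 f\<parallel>\<^sup>2 \<ge> 4 \<kappa>\<^sup>2 \<parallel>f\<parallel>\<^sup>2\<close>.\<close>

lemma operator_lower_bound:
  fixes m \<kappa> :: real
  assumes f: "f \<in> test_functions \<Omega>" and \<kappa>: "\<kappa> \<ge> 0"
    and first_order: "\<And>g. g \<in> test_functions \<Omega> \<Longrightarrow> \<kappa> * wint (\<lambda>x. (g x)\<^sup>2) \<le> wint (\<lambda>x. (radial_D g x)\<^sup>2)"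
    and second_order: "4 * \<kappa> * wint (\<lambda>x. (radial_D f x)\<^sup>2) \<le> wint (\<lambda>x. (radial_D (radial_D f) x)\<^sup>2)"
  shows "(4 * m\<^sup>2 + \<kappa>) * \<kappa> * wint (\<lambda>x. (f x)\<^sup>2)
    \<le> wint (\<lambda>x. (radial_D (radial_D f) x + 2 * m * radial_D f x + m\<^sup>2 * f x + angular_D (angular_D f) x)\<^sup>2)"
proof -
  define s where "s = angular_D f"
  define r where "r = angular_D s"
  have t: "s \<in> test_functions \<Omega>" "r \<in> test_functions \<Omega>"
    unfolding r_def s_def by (intro angular_D_test f)+
  define I where "I g = wint (\<lambda>x. (g x)\<^sup>2)" for g
  have n: "null (\<lambda>x. (- 2 * (m\<^sup>2 - \<kappa>)) * (s x * s x + f x * r x))"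
    using null_angular_skew[OF f t(1)] unfolding s_def r_def by (intro null_cmult)
  define U where "U x = (r x)\<^sup>2 + ((- 2 * (m\<^sup>2 - \<kappa>)) * (s x)\<^sup>2 + (m\<^sup>2 - \<kappa>)\<^sup>2 * (f x)\<^sup>2)" for x
  note c = test_imp_C0c[OF f, THEN C0c_power2] t[THEN test_imp_C0c, THEN C0c_power2]
  have U: "U \<in> C0c \<Omega>"
    unfolding U_def[abs_def] by (intro C0c_add C0c_cmult c)
  have "wint (\<lambda>x. (r x + (m\<^sup>2 - \<kappa>) * f x)\<^sup>2) \<le> wint U"
  proof (rule wint_le_null[OF _ U n])
    show "(\<lambda>x. (r x + (m\<^sup>2 - \<kappa>) * f x)\<^sup>2) \<in> C0c \<Omega>"
      by (intro C0c_power2 C0c_add C0c_cmult test_imp_C0c f t)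
    show "(r x + (m\<^sup>2 - \<kappa>) * f x)\<^sup>2 + (- 2 * (m\<^sup>2 - \<kappa>)) * (s x * s x + f x * r x) \<le> U x" for x
      unfolding U_def by (rule eq_refl) algebra
  qed
  moreover have "0 \<le> wint (\<lambda>x. (r x + (m\<^sup>2 - \<kappa>) * f x)\<^sup>2)"
    unfolding wint_def by (intro Bochner_Integration.integral_nonneg) auto
  moreover have "wint U = I r + (- 2 * (m\<^sup>2 - \<kappa>)) * I s + (m\<^sup>2 - \<kappa>)\<^sup>2 * I f"
    unfolding U_def[abs_def] I_def using c by (simp add: wint_add wint_cmult C0c_add C0c_cmult del: mult_minus_left minus_mult_minus)
  ultimately have 1: "0 \<le> I r + (- 2 * (m\<^sup>2 - \<kappa>)) * I s + (m\<^sup>2 - \<kappa>)\<^sup>2 * I f"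
    by linarith
  have 2: "\<kappa> * I f \<le> I (radial_D f)" "\<kappa> * I s \<le> I (radial_D s)"
    "4 * \<kappa> * I (radial_D f) \<le> I (radial_D (radial_D f))"
    unfolding I_def using first_order f t second_order by auto
  have If: "0 \<le> I f" unfolding I_def wint_def by (intro Bochner_Integration.integral_nonneg) auto
  have "2 * m\<^sup>2 * (\<kappa> * I f) \<le> 2 * m\<^sup>2 * I (radial_D f)"
    by (intro mult_left_mono 2) auto
  moreover have "4 * \<kappa> * (\<kappa> * I f) \<le> 4 * \<kappa> * I (radial_D f)"
    using \<kappa> by (intro mult_left_mono 2) auto
  moreover have "0 \<le> \<kappa>\<^sup>2 * I f" using If by simp
  ultimately have "(4 * m\<^sup>2 + \<kappa>) * \<kappa> * I f \<le> I (radial_D (radial_D f)) + 2 * m\<^sup>2 * I (radial_D f)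
      + m ^ 4 * I f + I r + 2 * I (radial_D s) - 2 * m\<^sup>2 * I s"
    using 1 2 by (simp add: algebra_simps power2_eq_square power4_eq_xxxx)
  then show ?thesis
    unfolding energy_identity[OF f] by (simp add: I_def s_def r_def)
qed

end

section \<open>Radial inequalities on an annulus\<close>

lemma ln_norm_bounds:
  fixes x :: "'a::real_normed_vector"
  assumes "0 < a" "x \<in> ball 0 b - cball 0 a"
  shows "ln a < ln (norm x)" "ln (norm x) < ln b" "x \<noteq> 0"
proof -
  have n: "a < norm x" "norm x < b" using assms by auto
  then have "0 < norm x" "0 < b" using assms(1) by linarith+
  then show "ln a < ln (norm x)" "ln (norm x) < ln b" "x \<noteq> 0"
    using assms(1) n by auto
qed

lemma radial_weight:
  fixes c c' :: "real \<Rightarrow> real"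
  assumes a: "0 < a"
    and D: "\<And>t. ln a < t \<Longrightarrow> t < ln b \<Longrightarrow> (c has_real_derivative c' t) (at t)"
    and cont: "continuous_on {ln a<..<ln b} c'"
  shows "C1_weight (ball 0 b - cball 0 a) (\<lambda>x::real^2. c (ln (norm x)))
    (\<lambda>x. (c' (ln (norm x)) / (norm x)\<^sup>2) *\<^sub>R x)"
proof -
  note ln = ln_norm_bounds[OF a]
  have "((\<lambda>x. c (ln (norm x))) has_derivative (\<lambda>v. ((c' (ln (norm x)) / (norm x)\<^sup>2) *\<^sub>R x) \<bullet> v)) (at x)"
    if x: "x \<in> ball 0 b - cball 0 a" for x :: "real^2"
  proof -
    have n: "(norm has_derivative (\<lambda>v. sgn x \<bullet> v)) (at x)"
      using has_derivative_norm[OF ln(3)[OF x]] by (simp add: inner_commute)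
    have l: "(ln has_derivative (\<lambda>v. inverse (norm x) * v)) (at (norm x))"
      using DERIV_ln[of "norm x"] ln(3)[OF x] by (simp add: has_field_derivative_def)
    have c: "(c has_derivative (\<lambda>v. c' (ln (norm x)) * v)) (at (ln (norm x)))"
      using D[OF ln(1,2)[OF x]] by (simp add: has_field_derivative_def)
    show ?thesis
      by (rule has_derivative_eq_rhs[OF has_derivative_compose[OF has_derivative_compose[OF n l] c]])
        (simp add: fun_eq_iff sgn_div_norm power2_eq_square field_simps)
  qed
  moreover have "continuous_on (ball 0 b - cball 0 a) (\<lambda>x::real^2. (c' (ln (norm x)) / (norm x)\<^sup>2) *\<^sub>R x)"
  proof -
    have "continuous_on (ball 0 b - cball 0 a) (\<lambda>x::real^2. c' (ln (norm x)))"
    proof (rule continuous_on_compose2[OF cont])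
      show "continuous_on (ball 0 b - cball 0 a) (\<lambda>x::real^2. ln (norm x))"
        using a by (intro continuous_intros) auto
      show "(\<lambda>x::real^2. ln (norm x)) ` (ball 0 b - cball 0 a) \<subseteq> {ln a<..<ln b}"
        by (rule image_subsetI) (use ln(1,2) in force)
    qed
    then show ?thesis using a by (intro continuous_intros) auto
  qed
  ultimately show ?thesis by (simp add: C1_weight_def)
qed

text \<open>The equation \<open>y'''' + y'' = 0\<close> of a buckling rod has the even solution \<open>1 + cos s\<close>, the buckling mode of
  \<open>(-\<pi>, \<pi>)\<close>, and the odd solution \<open>s + sin s\<close>. The bilinear concomitant of the equation vanishes on
  this pair, so a second order operator that annihilates both solutions completes the square. Its
  coefficients have as denominator the Wronskian \<open>2 + 2 cos s + s sin s\<close> of the pair.\<close>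

lemma buckling_wronskian_pos:
  fixes s :: real
  assumes "\<bar>s\<bar> < pi"
  shows "0 < 2 + 2 * cos s + s * sin s"
proof -
  have "cos pi < cos \<bar>s\<bar>" using assms by (intro cos_monotone_0_pi) auto
  then have "-1 < cos s" by simp
  moreover have "0 \<le> s * sin s"
  proof (cases "0 \<le> s")
    case True
    then show ?thesis using assms sin_ge_zero[of s] by simp
  next
    case False
    then show ?thesis using assms sin_ge_zero[of "-s"] by (simp add: mult_nonpos_nonpos)
  qed
  ultimately show ?thesis by linarith
qed

text \<open>Here \<open>V = W'\<close>, and \<open>y'' = (V / W) y' - ((1 + cos s) / W) y\<close> is the second order equation with
  solutions \<open>1 + cos s\<close> and \<open>s + sin s\<close>. The three derivatives are the system of
  \<open>radial_poincare_second_order\<close> for \<open>\<kappa> = 1\<close>.\<close>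

lemma
  fixes s :: real
  defines "W \<equiv> \<lambda>s. 2 + 2 * cos s + s * sin s" and "V \<equiv> \<lambda>s. s * cos s - sin s"
  assumes W: "W s \<noteq> 0"
  shows buckling_P: "((\<lambda>s. V s / W s) has_real_derivative (- 1 + 2 * ((1 + cos s) / W s) - (V s / W s)\<^sup>2)) (at s)"
    and buckling_Q: "((\<lambda>s. - ((1 + cos s) / W s)) has_real_derivative (sin s / W s + V s / W s * ((1 + cos s) / W s))) (at s)"
    and buckling_R: "((\<lambda>s. sin s / W s) has_real_derivative ((1 + cos s) / W s)\<^sup>2) (at s)"
proof -
  have dW: "(W has_real_derivative V s) (at s)"
    unfolding W_def V_def by (auto intro!: derivative_eq_intros)
  have dV: "(V has_real_derivative (- (s * sin s))) (at s)"
    unfolding V_def by (auto intro!: derivative_eq_intros)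
  have pyth: "(sin s)\<^sup>2 = 1 - (cos s)\<^sup>2" by (simp add: sin_squared_eq)
  have "(- (s * sin s)) * W s - V s * V s = (- 1 + 2 * ((1 + cos s) / W s) - (V s / W s)\<^sup>2) * (W s * W s)"
    using W by (simp add: field_simps power2_eq_square) (simp add: W_def algebra_simps)
  then show "((\<lambda>s. V s / W s) has_real_derivative (- 1 + 2 * ((1 + cos s) / W s) - (V s / W s)\<^sup>2)) (at s)"
    using W by (intro DERIV_cong[OF DERIV_divide[OF dV dW W]]) (simp add: divide_eq_eq)
  show "((\<lambda>s. - ((1 + cos s) / W s)) has_real_derivative (sin s / W s + V s / W s * ((1 + cos s) / W s))) (at s)"
    by (rule DERIV_cong[OF DERIV_minus[OF DERIV_divide[OF _ dW W]]])
      (auto intro!: derivative_eq_intros simp: W field_simps)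
  have "cos s * W s - sin s * V s = (1 + cos s)\<^sup>2"
    unfolding W_def V_def using pyth by algebra
  then show "((\<lambda>s. sin s / W s) has_real_derivative ((1 + cos s) / W s)\<^sup>2) (at s)"
    by (intro DERIV_cong[OF DERIV_divide[OF DERIV_sin dW W]]) (simp add: power2_eq_square)
qed

lemma DERIV_affine_arg:
  fixes f :: "real \<Rightarrow> real"
  assumes "(f has_real_derivative D) (at (k * (t - t0)))"
  shows "((\<lambda>t. \<alpha> * f (k * (t - t0))) has_real_derivative \<alpha> * (k * D)) (at t)"
proof -
  have "((\<lambda>t. k * (t - t0)) has_real_derivative k) (at t)"
    by (auto intro!: derivative_eq_intros)
  from DERIV_cmult[OF DERIV_chain2[OF assms this]] show ?thesis
    by (simp add: mult.commute)
qed

locale annulus =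
  fixes a b :: real
  assumes a_pos: "0 < a" and a_less_b: "a < b"
begin

abbreviation "\<Omega> \<equiv> ball 0 b - cball 0 a :: (real^2) set"

text \<open>The function \<open>cos (freq (t - mid))\<close> vanishes at \<open>t = ln a\<close> and \<open>t = ln b\<close> and is positive in
  between: it is the ground state of the Dirichlet problem in \<open>t\<close>.\<close>

definition "freq = pi / ln (b / a)"

definition "mid = (ln a + ln b) / 2"

lemma ln_pos: "0 < ln (b / a)"
  using a_pos a_less_b by simp

lemma freq_pos: "0 < freq"
  using ln_pos by (simp add: freq_def)

lemma scaled_bound:
  assumes "ln a < t" "t < ln b"
  shows "\<bar>freq * (t - mid)\<bar> < pi / 2"
proof -
  have "ln (b / a) = ln b - ln a" using a_pos a_less_b by (simp add: ln_div)
  then have "\<bar>t - mid\<bar> < ln (b / a) / 2"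
    using assms by (auto simp: mid_def abs_less_iff field_simps)
  then have "freq * \<bar>t - mid\<bar> < freq * (ln (b / a) / 2)" using freq_pos by simp
  then show ?thesis using ln_pos freq_pos by (simp add: abs_mult freq_def)
qed

sublocale punctured_domain \<Omega>
proof
  show "open \<Omega>" by (intro open_Diff) auto
  show "0 \<notin> \<Omega>" using a_pos by simp
qed

lemmas in_annulus = ln_norm_bounds[OF a_pos]

lemma poincare_annulus:
  assumes f: "f \<in> test_functions \<Omega>"
  shows "freq\<^sup>2 * wint (\<lambda>x. (f x)\<^sup>2) \<le> wint (\<lambda>x. (radial_D f x)\<^sup>2)"
proof -
  \<comment> \<open>the logarithmic derivative of the ground state\<close>
  define c where "c t = - freq * tan (freq * (t - mid))" for t
  define c' where "c' t = - freq\<^sup>2 - (c t)\<^sup>2" for t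
  have cos: "cos (freq * (t - mid)) \<noteq> 0" if "ln a < t" "t < ln b" for t
    using cos_gt_zero_pi[of "freq * (t - mid)"] scaled_bound[OF that] unfolding abs_less_iff by linarith
  have D: "(c has_real_derivative c' t) (at t)" if "ln a < t" "t < ln b" for t
  proof -
    have "- freq * (freq * inverse ((cos (freq * (t - mid)))\<^sup>2)) = c' t"
      unfolding power_inverse[symmetric] tan_sec[OF cos[OF that], symmetric] c'_def c_def
      by algebra
    then show ?thesis
      unfolding c_def[abs_def] using DERIV_affine_arg[OF DERIV_tan[OF cos[OF that]], of "-freq"] by simp
  qed
  have "continuous_on {ln a<..<ln b} c"
    using D[THEN DERIV_isCont] by (auto intro!: continuous_at_imp_continuous_on)
  then have "continuous_on {ln a<..<ln b} c'"
    unfolding c'_def by (intro continuous_intros)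
  note w = radial_weight[of a b c c', OF a_pos D this]
  show ?thesis
  proof (rule radial_poincare[OF f w])
    show "(c' (ln (norm x)) / (norm x)\<^sup>2) *\<^sub>R x \<bullet> x = - freq\<^sup>2 - (c (ln (norm x)))\<^sup>2" if "x \<in> \<Omega>" for x
      using in_annulus[OF that] by (simp add: c'_def power2_norm_eq_inner)
  qed
qed

lemma buckling_annulus:
  assumes f: "f \<in> test_functions \<Omega>"
  shows "4 * freq\<^sup>2 * wint (\<lambda>x. (radial_D f x)\<^sup>2) \<le> wint (\<lambda>x. (radial_D (radial_D f) x)\<^sup>2)"
proof -
  define W where "W s = 2 + 2 * cos s + s * sin s" for s :: real
  define A where "A s = (1 + cos s) / W s" for s
  define B where "B s = (s * cos s - sin s) / W s" for s
  define C where "C s = sin s / W s" for s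
  \<comment> \<open>the argument \<open>2 freq (t - mid)\<close> maps the interval onto \<open>(-\<pi>, \<pi>)\<close>, whence the constant \<open>(2 freq)\<^sup>2\<close>\<close>
  define P where "P t = 2 * freq * B (2 * freq * (t - mid))" for t
  define Q where "Q t = (2 * freq)\<^sup>2 * - A (2 * freq * (t - mid))" for t
  define R where "R t = (2 * freq) ^ 3 * C (2 * freq * (t - mid))" for t
  define P' where "P' t = - (4 * freq\<^sup>2) - 2 * Q t - (P t)\<^sup>2" for t
  define Q' where "Q' t = R t - P t * Q t" for t
  define R' where "R' t = (Q t)\<^sup>2" for t
  have P: "(P has_real_derivative P' t) (at t)"
    and Q: "(Q has_real_derivative Q' t) (at t)"
    and R: "(R has_real_derivative R' t) (at t)" if "ln a < t" "t < ln b" for t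
  proof -
    define s where "s = 2 * freq * (t - mid)"
    have "\<bar>s\<bar> < pi"
      using scaled_bound[OF that] by (simp add: abs_mult s_def)
    from buckling_wronskian_pos[OF this]
    have w: "2 + 2 * cos s + s * sin s \<noteq> 0" by simp
    have B: "(B has_real_derivative (- 1 + 2 * A s - (B s)\<^sup>2)) (at s)"
      using buckling_P[OF w] by (simp add: A_def B_def[abs_def] W_def)
    have A: "((\<lambda>s. - A s) has_real_derivative (C s + B s * A s)) (at s)"
      using buckling_Q[OF w] by (simp add: A_def[abs_def] B_def C_def W_def)
    have C: "(C has_real_derivative (A s)\<^sup>2) (at s)"
      using buckling_R[OF w] by (simp add: A_def C_def[abs_def] W_def)
    show "(P has_real_derivative P' t) (at t)"
      using DERIV_affine_arg[OF B[unfolded s_def], of "2 * freq"]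
      by (simp add: P_def[abs_def] P'_def Q_def algebra_simps power2_eq_square)
    show "(Q has_real_derivative Q' t) (at t)"
      using DERIV_affine_arg[OF A[unfolded s_def], of "(2 * freq)\<^sup>2"]
      by (simp add: P_def Q_def[abs_def] Q'_def R_def algebra_simps power2_eq_square power3_eq_cube)
    show "(R has_real_derivative R' t) (at t)"
      using DERIV_affine_arg[OF C[unfolded s_def], of "(2 * freq) ^ 3"]
      by (simp add: R_def[abs_def] R'_def Q_def algebra_simps power2_eq_square power3_eq_cube)
  qed
  have "continuous_on {ln a<..<ln b} P" "continuous_on {ln a<..<ln b} Q" "continuous_on {ln a<..<ln b} R"
    using P[THEN DERIV_isCont] Q[THEN DERIV_isCont] R[THEN DERIV_isCont]
    by (auto intro!: continuous_at_imp_continuous_on)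
  then have c: "continuous_on {ln a<..<ln b} P'" "continuous_on {ln a<..<ln b} Q'" "continuous_on {ln a<..<ln b} R'"
    unfolding P'_def[abs_def] Q'_def[abs_def] R'_def[abs_def]
    by - (rule continuous_intros | assumption)+
  note w = radial_weight[of a b P P', OF a_pos P c(1)] radial_weight[of a b Q Q', OF a_pos Q c(2)]
    radial_weight[of a b R R', OF a_pos R c(3)]
  show ?thesis
    by (rule radial_poincare_second_order[OF f w])
      (use in_annulus(3) in \<open>auto simp: P'_def Q'_def R'_def power2_norm_eq_inner\<close>)
qed

lemma test_function_inequality:
  assumes "f \<in> test_functions \<Omega>"
  shows "(4 * m\<^sup>2 + freq\<^sup>2) * freq\<^sup>2 * wint (\<lambda>x. (f x)\<^sup>2)
    \<le> wint (\<lambda>x. (radial_D (radial_D f) x + 2 * m * radial_D f x + m\<^sup>2 * f x + angular_D (angular_D f) x)\<^sup>2)"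
  using operator_lower_bound[OF assms _ poincare_annulus buckling_annulus[OF assms], of m] by simp

end

section \<open>Smooth bumps and the fundamental lemma of the calculus of variations\<close>

text \<open>Functions \<open>p (1 / t) exp (- 1 / t)\<close> for \<open>t > 0\<close>, extended by zero, with a polynomial \<open>p\<close>: this class
  contains the classical flat function (for \<open>p = 1\<close>) and is stable under differentiation.\<close>

definition flat_exp :: "real poly \<Rightarrow> real \<Rightarrow> real" where
  "flat_exp p t = (if 0 < t then poly p (1 / t) * exp (- (1 / t)) else 0)"

definition flat_exp_deriv :: "real poly \<Rightarrow> real poly" where
  "flat_exp_deriv p = [:0, 0, 1:] * (p - pderiv p)"

lemma poly_exp_tendsto_0: "((\<lambda>s::real. poly p s * exp (- s)) \<longlongrightarrow> 0) at_top"
proof -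
  have "((\<lambda>s::real. \<Sum>i\<le>degree p. coeff p i * (s ^ i / exp s)) \<longlongrightarrow> (\<Sum>i\<le>degree p. coeff p i * 0)) at_top"
    by (intro tendsto_sum tendsto_mult tendsto_const tendsto_power_div_exp_0)
  then show ?thesis
    by (simp add: poly_altdef exp_minus sum_distrib_right divide_inverse mult.assoc)
qed

lemma flat_exp_has_derivative:
  "(flat_exp p has_real_derivative flat_exp (flat_exp_deriv p) t) (at t)"
proof -
  consider "t < 0" | "t = 0" | "0 < t" by linarith
  then show ?thesis
  proof cases
    case 1
    have "((\<lambda>t. 0) has_real_derivative flat_exp (flat_exp_deriv p) t) (at t)"
      using 1 by (simp add: flat_exp_def)
    then show ?thesis
      by (rule has_field_derivative_transform_within_open[of _ _ _ "{..<0}"])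
        (use 1 in \<open>auto simp: flat_exp_def\<close>)
  next
    case 2
    have "((\<lambda>h. flat_exp p h / h) \<longlongrightarrow> 0) (at_left 0)"
      by (rule tendsto_eventually) (auto simp: flat_exp_def eventually_at_filter)
    moreover have "((\<lambda>h. flat_exp p h / h) \<longlongrightarrow> 0) (at_right 0)"
    proof -
      have "((\<lambda>h. poly (pCons 0 p) (inverse h) * exp (- inverse h)) \<longlongrightarrow> 0) (at_right 0)"
        by (rule filterlim_compose[OF poly_exp_tendsto_0 filterlim_inverse_at_top_right])
      then show ?thesis
        by (rule Lim_transform_eventually)
          (auto simp: flat_exp_def eventually_at_filter field_simps)
    qed
    ultimately have "((\<lambda>h. flat_exp p h / h) \<longlongrightarrow> 0) (at 0)"
      by (simp add: filterlim_at_split)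
    then show ?thesis
      using 2 by (simp add: DERIV_def flat_exp_def)
  next
    case 3
    have "((\<lambda>t. poly p (1 / t) * exp (- (1 / t))) has_real_derivative flat_exp (flat_exp_deriv p) t) (at t)"
    proof -
      have i: "((\<lambda>t. 1 / t) has_real_derivative - (1 / t\<^sup>2)) (at t)"
        using 3 by (auto intro!: derivative_eq_intros simp: power2_eq_square)
      have "((\<lambda>t. poly p (1 / t)) has_real_derivative poly (pderiv p) (1 / t) * - (1 / t\<^sup>2)) (at t)"
        by (rule DERIV_chain2[OF poly_DERIV i])
      moreover have "((\<lambda>t. exp (- (1 / t))) has_real_derivative exp (- (1 / t)) * - (- (1 / t\<^sup>2))) (at t)"
        by (rule DERIV_chain2[OF DERIV_exp DERIV_minus[OF i]])
      ultimately have "((\<lambda>t. poly p (1 / t) * exp (- (1 / t))) has_real_derivative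
          (poly (pderiv p) (1 / t) * - (1 / t\<^sup>2)) * exp (- (1 / t))
            + (exp (- (1 / t)) * - (- (1 / t\<^sup>2))) * poly p (1 / t)) (at t)"
        by (rule DERIV_mult)
      then show ?thesis
        by (rule DERIV_cong)
          (use 3 in \<open>simp add: flat_exp_def flat_exp_deriv_def power2_eq_square algebra_simps\<close>)
    qed
    then show ?thesis
      by (rule has_field_derivative_transform_within_open[of _ _ _ "{0<..}"])
        (use 3 in \<open>auto simp: flat_exp_def\<close>)
  qed
qed

lemma smooth_flat_exp_coord: "smooth (\<lambda>x::real^'n::finite. flat_exp p (\<alpha> + \<beta> * x $ j))"
proof (rule smooth_coinduct)
  let ?S = "{\<lambda>x::real^'n. \<gamma> * flat_exp p (\<alpha> + \<beta> * x $ j) | \<gamma> p. True}"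
  have D: "((\<lambda>x::real^'n. \<gamma> * flat_exp p (\<alpha> + \<beta> * x $ j)) has_derivative
      (\<lambda>v. \<gamma> * (flat_exp (flat_exp_deriv p) (\<alpha> + \<beta> * x $ j) * (\<beta> * v $ j)))) (at x)" for \<gamma> p x
  proof -
    have c: "((\<lambda>x::real^'n. \<alpha> + \<beta> * x $ j) has_derivative (\<lambda>v. \<beta> * v $ j)) (at x)"
      using has_derivative_add[OF has_derivative_const has_derivative_mult_right[OF
          bounded_linear_imp_has_derivative[OF bounded_linear_vec_nth]]] by simp
    show ?thesis
      by (rule has_derivative_mult_right[OF has_derivative_compose[OF c
            flat_exp_has_derivative[unfolded has_field_derivative_def]]])
  qed
  show "(\<lambda>x::real^'n. flat_exp p (\<alpha> + \<beta> * x $ j)) \<in> ?S"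
    by (rule CollectI) (intro exI[of _ 1] exI[of _ p], simp)
  show "f differentiable (at x)" if "f \<in> ?S" for f x
    using that D unfolding differentiable_def by blast
  show "partial_deriv i f \<in> ?S" if fS: "f \<in> ?S" for f i
  proof -
    obtain \<gamma> p where f: "f = (\<lambda>x::real^'n. \<gamma> * flat_exp p (\<alpha> + \<beta> * x $ j))"
      using fS by blast
    have "partial_deriv i f = (\<lambda>x. (\<gamma> * \<beta> * (if i = j then 1 else 0)) * flat_exp (flat_exp_deriv p) (\<alpha> + \<beta> * x $ j))"
      unfolding f by (rule ext, subst partial_deriv_eqI[OF D]) (simp add: axis_def)
    then show ?thesis by blast
  qed
qed

text \<open>These functions increase to the indicator function of the open box, since \<open>exp (- 1 / (n t))\<close>
  increases to \<open>1\<close> for \<open>t > 0\<close>. The factor is \<open>Suc n\<close> because \<open>n = 0\<close> would give the zero function.\<close>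

definition bump :: "nat \<Rightarrow> real^'n::finite \<Rightarrow> real^'n \<Rightarrow> real^'n \<Rightarrow> real" where
  "bump n c d x = (\<Prod>i\<in>UNIV. flat_exp 1 (real (Suc n) * (x $ i - c $ i)) * flat_exp 1 (real (Suc n) * (d $ i - x $ i)))"

lemma flat_exp_1_bounds: "0 \<le> flat_exp 1 t" "flat_exp 1 t \<le> 1"
  by (auto simp: flat_exp_def)

lemma bump_bounds: "0 \<le> bump n c d x" "bump n c d x \<le> 1"
  unfolding bump_def
  by (auto intro!: prod_nonneg prod_le_1 mult_le_one mult_nonneg_nonneg flat_exp_1_bounds)

lemma bump_outside: "x \<notin> box c d \<Longrightarrow> bump n c d x = 0"
  by (auto simp: bump_def mem_box_cart flat_exp_def zero_less_mult_iff intro!: bexI)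

lemma bump_test:
  assumes "cbox c d \<subseteq> \<Omega>"
  shows "bump n c d \<in> test_functions \<Omega>"
proof -
  have "smooth (bump n c d)"
  proof -
    have "bump n c d = (\<lambda>x. \<Prod>i\<in>UNIV. flat_exp 1 (- (real (Suc n) * c $ i) + real (Suc n) * x $ i)
        * flat_exp 1 (real (Suc n) * d $ i + (- real (Suc n)) * x $ i))"
      by (rule ext) (simp add: bump_def algebra_simps)
    then show ?thesis
      by (simp only:) (intro smooth_prod smooth_mult smooth_flat_exp_coord)
  qed
  moreover have "supported_in \<Omega> (bump n c d)"
    unfolding supported_in_def
  proof (intro exI[of _ "cbox c d"] conjI allI impI)
    show "bump n c d x = 0" if "x \<notin> cbox c d" for x
      using that box_subset_cbox[of c d] by (intro bump_outside) auto
  qed (use assms in auto)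
  ultimately show ?thesis by (simp add: test_functions_iff)
qed

lemma bump_tendsto_1:
  assumes "x \<in> box c d"
  shows "(\<lambda>n. bump n c d x) \<longlonglongrightarrow> 1"
proof -
  have e: "(\<lambda>n. flat_exp 1 (real (Suc n) * t)) \<longlonglongrightarrow> 1" if "0 < t" for t
  proof -
    have "(\<lambda>n. exp (- (inverse (real (Suc n)) * (1 / t)))) \<longlonglongrightarrow> exp (- (0 * (1 / t)))"
      by (intro tendsto_intros LIMSEQ_inverse_real_of_nat)
    moreover have "flat_exp 1 (real (Suc n) * t) = exp (- (inverse (real (Suc n)) * (1 / t)))" for n
    proof -
      have "0 < real (Suc n) * t" using that by (intro mult_pos_pos) auto
      then show ?thesis by (simp add: flat_exp_def divide_inverse mult.commute)
    qed
    ultimately show ?thesis by simp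
  qed
  have "(\<lambda>n. bump n c d x) \<longlonglongrightarrow> (\<Prod>i\<in>(UNIV::'a set). 1 * 1)"
    unfolding bump_def using assms
    by (intro tendsto_prod tendsto_mult e) (auto simp: mem_box_cart)
  then show ?thesis by simp
qed

lemma
  fixes f :: "real^'n::finite \<Rightarrow> real"
  assumes "S \<in> sets lebesgue" "\<And>x. x \<notin> S \<Longrightarrow> f x = 0"
  shows integrable_lebesgue_on_supported: "integrable (lebesgue_on S) f \<longleftrightarrow> integrable lebesgue f"
    and integral_lebesgue_on_supported: "(LINT x|lebesgue_on S. f x) = (LINT x|lebesgue. f x)"
proof -
  have "(\<lambda>x. if x \<in> S then f x else 0) = f" using assms(2) by auto
  then show "integrable (lebesgue_on S) f \<longleftrightarrow> integrable lebesgue f"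
    "(LINT x|lebesgue_on S. f x) = (LINT x|lebesgue. f x)"
    using Lebesgue_Measure.integrable_restrict_UNIV[OF assms(1), of f]
      Lebesgue_Measure.integral_restrict_UNIV[OF assms(1), of f] by simp_all
qed

lemma
  assumes f: "f \<in> C0c \<Omega>" and \<Omega>: "\<Omega> \<in> sets lebesgue"
  shows C0c_integrable_lebesgue_on: "integrable (lebesgue_on \<Omega>) f"
    and C0c_integral_lebesgue_on: "(LINT x|lebesgue_on \<Omega>. f x) = (LINT x|lborel. f x)"
proof -
  have o: "f x = 0" if "x \<notin> \<Omega>" for x
    using f that unfolding C0c_def supported_in_def by blast
  have m: "f \<in> lborel \<rightarrow>\<^sub>M borel"
    using C0c_integrable[OF f] by auto
  show "integrable (lebesgue_on \<Omega>) f"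
    using C0c_integrable[OF f] integrable_lebesgue_on_supported[OF \<Omega> o] integrable_completion[OF m] by simp
  show "(LINT x|lebesgue_on \<Omega>. f x) = (LINT x|lborel. f x)"
    using integral_lebesgue_on_supported[OF \<Omega> o] integral_completion[OF m] by simp
qed

lemma locally_integrable_mult:
  assumes g: "locally_integrable \<Omega> g" and f: "f \<in> C0c \<Omega>" and \<Omega>: "\<Omega> \<in> sets lebesgue"
  shows "integrable (lebesgue_on \<Omega>) (\<lambda>x. g x * f x)"
proof -
  obtain K where K: "compact K" "K \<subseteq> \<Omega>" "\<And>x. x \<notin> K \<Longrightarrow> f x = 0"
    using f unfolding C0c_def supported_in_def by blast
  have Kl: "K \<in> sets lebesgue" using K(1) by (simp add: lmeasurable_compact fmeasurableD)
  have gK: "integrable (lebesgue_on K) g"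
    using g K unfolding locally_integrable_def by blast
  have cf: "continuous_on K f" using f by (auto simp: C0c_def intro: continuous_on_subset)
  then obtain B where B: "\<And>x. x \<in> K \<Longrightarrow> \<bar>f x\<bar> \<le> B"
    using compact_imp_bounded[OF compact_continuous_image[OF cf K(1)]]
    unfolding bounded_iff by fastforce
  have "integrable (lebesgue_on K) (\<lambda>x. g x * f x)"
  proof (rule Bochner_Integration.integrable_bound)
    show "integrable (lebesgue_on K) (\<lambda>x. B * g x)" using gK by simp
    show "(\<lambda>x. g x * f x) \<in> borel_measurable (lebesgue_on K)"
      using gK continuous_imp_measurable_on_sets_lebesgue[OF cf Kl]
      by (intro borel_measurable_times) auto
    show "AE x in lebesgue_on K. norm (g x * f x) \<le> norm (B * g x)"
    proof (rule AE_I2)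
      fix x assume "x \<in> space (lebesgue_on K)"
      then have "\<bar>f x\<bar> \<le> \<bar>B\<bar>" using B[of x] by simp
      then have "\<bar>g x\<bar> * \<bar>f x\<bar> \<le> \<bar>g x\<bar> * \<bar>B\<bar>" by (intro mult_left_mono) auto
      then show "norm (g x * f x) \<le> norm (B * g x)"
        by (simp add: abs_mult mult.commute)
    qed
  qed
  then have "integrable lebesgue (\<lambda>x. g x * f x)"
    using integrable_lebesgue_on_supported[OF Kl, of "\<lambda>x. g x * f x"] K(3) by simp
  moreover have "g x * f x = 0" if "x \<notin> \<Omega>" for x
    using K that by (metis mult_zero_right subsetD)
  ultimately show ?thesis
    using integrable_lebesgue_on_supported[OF \<Omega>, of "\<lambda>x. g x * f x"] by simp
qed

text \<open>Testing against the bumps of the box and passing to the limit by dominated convergence gives the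
  integral over the open box, which differs from the closed one by a null set.\<close>

lemma integral_cbox_eq_0:
  fixes g :: "real^'n::finite \<Rightarrow> real"
  assumes g: "locally_integrable \<Omega> g" and \<Omega>: "open \<Omega>"
    and ortho: "\<And>\<phi>. \<phi> \<in> test_functions \<Omega> \<Longrightarrow> (LINT x|lebesgue_on \<Omega>. g x * \<phi> x) = 0"
    and cd: "cbox c d \<subseteq> \<Omega>"
  shows "integral (cbox c d) g = 0"
proof -
  have \<Omega>l: "\<Omega> \<in> sets lebesgue" using \<Omega> by auto
  have gi: "integrable (lebesgue_on (cbox c d)) g"
    using g cd unfolding locally_integrable_def by auto
  then have gi': "integrable lebesgue (\<lambda>x. if x \<in> cbox c d then g x else 0)"
    by (subst Lebesgue_Measure.integrable_restrict_UNIV) auto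
  have gb: "integrable lebesgue (\<lambda>x. if x \<in> box c d then g x else 0)"
  proof -
    have "integrable lebesgue (\<lambda>x. indicator (box c d) x *\<^sub>R (if x \<in> cbox c d then g x else 0))"
      using gi' by (rule integrable_mult_indicator[rotated]) simp
    moreover have "(\<lambda>x. indicator (box c d) x *\<^sub>R (if x \<in> cbox c d then g x else 0))
        = (\<lambda>x. if x \<in> box c d then g x else 0)"
      using box_subset_cbox[of c d] by (intro ext) (auto simp: indicator_def)
    ultimately show ?thesis by simp
  qed
  have "(\<lambda>n. LINT x|lebesgue. g x * bump n c d x) \<longlonglongrightarrow> (LINT x|lebesgue. (if x \<in> box c d then g x else 0))"
  proof (rule integral_dominated_convergence[where w = "\<lambda>x. \<bar>if x \<in> cbox c d then g x else 0\<bar>"])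
    show "(\<lambda>x. if x \<in> box c d then g x else 0) \<in> borel_measurable lebesgue"
      using gb by auto
    show "(\<lambda>x. g x * bump n c d x) \<in> borel_measurable lebesgue" for n
    proof -
      have "integrable (lebesgue_on \<Omega>) (\<lambda>x. g x * bump n c d x)"
        by (intro locally_integrable_mult g test_imp_C0c bump_test cd \<Omega>l)
      moreover have "g x * bump n c d x = 0" if "x \<notin> \<Omega>" for x
        using bump_outside[of x c d n] that cd box_subset_cbox[of c d] by auto
      ultimately have "integrable lebesgue (\<lambda>x. g x * bump n c d x)"
        using integrable_lebesgue_on_supported[OF \<Omega>l, of "\<lambda>x. g x * bump n c d x"] by simp
      then show ?thesis by auto
    qed
    show "integrable lebesgue (\<lambda>x. \<bar>if x \<in> cbox c d then g x else 0\<bar>)"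
      using gi' by (rule integrable_abs)
    show "AE x in lebesgue. (\<lambda>n. g x * bump n c d x) \<longlonglongrightarrow> (if x \<in> box c d then g x else 0)"
    proof (rule AE_I2)
      fix x show "(\<lambda>n. g x * bump n c d x) \<longlonglongrightarrow> (if x \<in> box c d then g x else 0)"
        using tendsto_mult[OF tendsto_const bump_tendsto_1, of x c d "g x"]
        by (auto simp: bump_outside)
    qed
    show "AE x in lebesgue. norm (g x * bump n c d x) \<le> \<bar>if x \<in> cbox c d then g x else 0\<bar>" for n
    proof (rule AE_I2)
      fix x
      show "norm (g x * bump n c d x) \<le> \<bar>if x \<in> cbox c d then g x else 0\<bar>"
      proof (cases "x \<in> box c d")
        case True
        have "\<bar>g x\<bar> * \<bar>bump n c d x\<bar> \<le> \<bar>g x\<bar> * 1"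
          by (intro mult_left_mono) (use bump_bounds[of n c d x] in auto)
        then show ?thesis
          using True box_subset_cbox[of c d] by (auto simp: abs_mult)
      qed (simp add: bump_outside)
    qed
  qed
  moreover have "(LINT x|lebesgue. g x * bump n c d x) = 0" for n
  proof -
    have "g x * bump n c d x = 0" if "x \<notin> \<Omega>" for x
      using bump_outside[of x c d n] that cd box_subset_cbox[of c d] by auto
    then show ?thesis
      using integral_lebesgue_on_supported[OF \<Omega>l, of "\<lambda>x. g x * bump n c d x"]
        ortho[OF bump_test[OF cd, of n]] by simp
  qed
  ultimately have "(LINT x|lebesgue. (if x \<in> box c d then g x else 0)) = 0"
    using LIMSEQ_unique[OF _ tendsto_const[of 0 sequentially]] by simp
  then have "integral\<^sup>L (lebesgue_on (box c d)) g = 0"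
    by (subst (asm) Lebesgue_Measure.integral_restrict_UNIV) auto
  moreover have "integrable (lebesgue_on (box c d)) g"
    using gb by (subst (asm) Lebesgue_Measure.integrable_restrict_UNIV) auto
  ultimately have "integral (box c d) g = 0"
    using lebesgue_integral_eq_integral[of "box c d" g] by simp
  then show ?thesis by (simp add: integral_open_interval)
qed

text \<open>All averages over small cubes inside \<open>\<Omega>\<close> vanish, and almost everywhere they converge to the
  value of the function.\<close>

lemma fundamental_lemma:
  fixes g :: "real^'n::finite \<Rightarrow> real"
  assumes g: "locally_integrable \<Omega> g" and \<Omega>: "open \<Omega>"
    and ortho: "\<And>\<phi>. \<phi> \<in> test_functions \<Omega> \<Longrightarrow> (LINT x|lebesgue_on \<Omega>. g x * \<phi> x) = 0"
  shows "AE x in lebesgue_on \<Omega>. g x = 0"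
proof -
  have box: "negligible {x \<in> box c d. g x \<noteq> 0}" if cd: "cbox c d \<subseteq> \<Omega>" for c d
  proof -
    \<comment> \<open>extended by zero from a box, since the differentiation theorem asks for integrability on all boxes\<close>
    define f where "f x = (if x \<in> cbox c d then g x else 0)" for x
    have "integrable (lebesgue_on (cbox c d)) g"
      using g cd unfolding locally_integrable_def by auto
    then have "integrable lebesgue f"
      unfolding f_def by (subst Lebesgue_Measure.integrable_restrict_UNIV) auto
    then have "f integrable_on UNIV" by (rule integrable_on_lebesgue)
    then have "f integrable_on cbox p q" for p q
      by (rule integrable_on_subcbox) simp
    from integrable_ccontinuous_explicit[OF this] obtain N where N: "negligible N"
      "\<And>x e. \<lbrakk>x \<notin> N; 0 < e\<rbrakk> \<Longrightarrow> \<exists>\<delta>>0. \<forall>h. 0 < h \<and> h < \<delta> \<longrightarrow>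
         norm (integral (cbox x (x + h *\<^sub>R One)) f /\<^sub>R h ^ DIM(real^'n) - f x) < e"
      by metis
    have "g x = 0" if x: "x \<in> box c d" "x \<notin> N" for x
    proof (rule ccontr)
      assume gx: "g x \<noteq> 0"
      obtain \<delta> where \<delta>: "\<delta> > 0" "\<And>h. 0 < h \<Longrightarrow> h < \<delta> \<Longrightarrow>
         norm (integral (cbox x (x + h *\<^sub>R One)) f /\<^sub>R h ^ DIM(real^'n) - f x) < \<bar>g x\<bar>"
        using N(2)[OF x(2), of "\<bar>g x\<bar>"] gx by auto
      have "((\<lambda>h. x + h *\<^sub>R One) \<longlongrightarrow> x + 0 *\<^sub>R One) (at_right 0)"
        by (intro tendsto_intros)
      then have "eventually (\<lambda>h. x + h *\<^sub>R One \<in> box c d) (at_right 0)"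
        using x(1) by (intro topological_tendstoD[of _ x _ "box c d"] open_box) simp_all
      then have "eventually (\<lambda>h::real. x + h *\<^sub>R One \<in> box c d \<and> h < \<delta> \<and> 0 < h) (at_right 0)"
        using \<delta>(1) by (intro eventually_conj) (auto simp: eventually_at_right_less eventually_at_right_field)
      then obtain h where h: "x + h *\<^sub>R One \<in> box c d" "h < \<delta>" "0 < h"
        using eventually_happens trivial_limit_at_right_real by blast
      have sub: "cbox x (x + h *\<^sub>R One) \<subseteq> cbox c d"
        by (rule subset_box_imp(1)) (use x(1) h(1) in \<open>auto simp: mem_box intro: less_imp_le\<close>)
      have "integral (cbox x (x + h *\<^sub>R One)) f = integral (cbox x (x + h *\<^sub>R One)) g"
        by (rule Henstock_Kurzweil_Integration.integral_cong) (use sub in \<open>auto simp: f_def\<close>)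
      also have "\<dots> = 0"
        by (rule integral_cbox_eq_0[OF g \<Omega> ortho]) (use sub cd in auto)
      finally have "\<bar>f x\<bar> < \<bar>g x\<bar>" using \<delta>(2)[OF h(3,2)] by simp
      then show False using x(1) box_subset_cbox[of c d] by (auto simp: f_def)
    qed
    then have "{x \<in> box c d. g x \<noteq> 0} \<subseteq> N" by blast
    then show ?thesis using N(1) negligible_subset by blast
  qed
  obtain \<D> where \<D>: "countable \<D>" "\<D> \<subseteq> Pow \<Omega>" "\<And>X. X \<in> \<D> \<Longrightarrow> \<exists>c d. X = cbox c d" "\<Union>\<D> = \<Omega>"
    using open_countable_Union_open_cbox[OF \<Omega>] by metis
  have "negligible {x \<in> X. g x \<noteq> 0}" if XD: "X \<in> \<D>" for X
  proof -
    obtain c d where X: "X = cbox c d" using \<D>(3)[OF XD] by blast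
    then have "negligible {x \<in> box c d. g x \<noteq> 0}" using box \<D>(2) XD by blast
    moreover have "negligible (cbox c d - box c d)"
      using negligible_frontier_interval by blast
    ultimately have "negligible ({x \<in> box c d. g x \<noteq> 0} \<union> (cbox c d - box c d))" by simp
    then show ?thesis by (rule negligible_subset) (auto simp: X)
  qed
  then have "negligible (\<Union>X\<in>\<D>. {x \<in> X. g x \<noteq> 0})"
    using \<D>(1) by (intro negligible_countable_Union) auto
  moreover have "(\<Union>X\<in>\<D>. {x \<in> X. g x \<noteq> 0}) = {x \<in> \<Omega>. g x \<noteq> 0}" using \<D>(4) by blast
  ultimately have "{x \<in> \<Omega>. g x \<noteq> 0} \<in> null_sets lebesgue"
    by (simp add: negligible_iff_null_sets)
  then have "AE x in lebesgue. x \<notin> {x \<in> \<Omega>. g x \<noteq> 0}" by (rule AE_not_in)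
  then show ?thesis
    using \<Omega> by (subst AE_restrict_space_iff) (auto elim: eventually_mono)
qed

section \<open>Weak derivatives and square integrable functions\<close>

lemma has_weak_deriv_diff:
  assumes u: "has_weak_deriv \<Omega> I u g" and v: "has_weak_deriv \<Omega> I v h" and \<Omega>: "open \<Omega>"
  shows "has_weak_deriv \<Omega> I (\<lambda>x. u x - v x) (\<lambda>x. g x - h x)"
proof -
  have \<Omega>l: "\<Omega> \<in> sets lebesgue" using \<Omega> by auto
  have l: "locally_integrable \<Omega> u" "locally_integrable \<Omega> v" "locally_integrable \<Omega> g" "locally_integrable \<Omega> h"
    using u v by (auto simp: has_weak_deriv_def)
  have "locally_integrable \<Omega> (\<lambda>x. u x - v x)" "locally_integrable \<Omega> (\<lambda>x. g x - h x)"
    using l by (auto simp: locally_integrable_def)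
  moreover have "(LINT x|lebesgue_on \<Omega>. (u x - v x) * partial_derivs I \<phi> x)
      = (-1) ^ length I * (LINT x|lebesgue_on \<Omega>. (g x - h x) * \<phi> x)" if \<phi>: "\<phi> \<in> test_functions \<Omega>" for \<phi>
  proof -
    have i: "integrable (lebesgue_on \<Omega>) (\<lambda>x. w x * partial_derivs I \<phi> x)"
      "integrable (lebesgue_on \<Omega>) (\<lambda>x. w x * \<phi> x)" if "locally_integrable \<Omega> w" for w
      by (intro locally_integrable_mult that \<Omega>l test_imp_C0c test_partial_derivs \<phi>)+
    have e: "(LINT x|lebesgue_on \<Omega>. u x * partial_derivs I \<phi> x) = (-1) ^ length I * (LINT x|lebesgue_on \<Omega>. g x * \<phi> x)"
      "(LINT x|lebesgue_on \<Omega>. v x * partial_derivs I \<phi> x) = (-1) ^ length I * (LINT x|lebesgue_on \<Omega>. h x * \<phi> x)"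
      using u v \<phi> by (simp_all add: has_weak_deriv_def)
    show ?thesis
      using i[OF l(1)] i[OF l(2)] i[OF l(3)] i[OF l(4)] e
      by (simp add: left_diff_distrib right_diff_distrib)
  qed
  ultimately show ?thesis by (simp add: has_weak_deriv_def)
qed

lemma has_weak_deriv_unique:
  assumes g: "has_weak_deriv \<Omega> I u g" and h: "has_weak_deriv \<Omega> I u h" and \<Omega>: "open \<Omega>"
  shows "AE x in lebesgue_on \<Omega>. g x = h x"
proof -
  have "has_weak_deriv \<Omega> I (\<lambda>x. u x - u x) (\<lambda>x. g x - h x)"
    by (rule has_weak_deriv_diff[OF g h \<Omega>])
  then have "AE x in lebesgue_on \<Omega>. g x - h x = 0"
    by (intro fundamental_lemma \<Omega>) (auto simp: has_weak_deriv_def)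
  then show ?thesis by (auto elim: eventually_mono)
qed

lemma C0c_locally_integrable:
  assumes "f \<in> C0c \<Omega>"
  shows "locally_integrable \<Omega> f"
  unfolding locally_integrable_def
proof (intro allI impI)
  fix K assume K: "compact K \<and> K \<subseteq> \<Omega>"
  then have Kl: "K \<in> sets lebesgue" by (simp add: lmeasurable_compact fmeasurableD)
  have m: "f \<in> lborel \<rightarrow>\<^sub>M borel" using C0c_integrable[OF assms] by auto
  have "integrable lebesgue f"
    using C0c_integrable[OF assms] integrable_completion[OF m] by simp
  then have "integrable lebesgue (\<lambda>x. indicator K x *\<^sub>R f x)"
    by (rule integrable_mult_indicator[OF Kl])
  then show "integrable (lebesgue_on K) f"
    using Kl by (subst integrable_restrict_space) auto
qed

text \<open>Integrating by parts one direction at a time moves the outermost derivative first, so the order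
  of differentiation is reversed.\<close>

lemma test_has_weak_deriv:
  assumes \<phi>: "\<phi> \<in> test_functions \<Omega>" and \<Omega>: "open \<Omega>"
  shows "has_weak_deriv \<Omega> I \<phi> (partial_derivs (rev I) \<phi>)"
proof -
  have \<Omega>l: "\<Omega> \<in> sets lebesgue" using \<Omega> by auto
  have ibp: "(LINT x|lborel. \<phi> x * partial_derivs I \<psi> x)
      = (-1) ^ length I * (LINT x|lborel. partial_derivs (rev I) \<phi> x * \<psi> x)"
    if "\<phi> \<in> test_functions \<Omega>" "\<psi> \<in> test_functions \<Omega>" for \<phi> \<psi>
    using that
  proof (induction I arbitrary: \<phi>)
    case Nil
    then show ?case by (simp add: partial_derivs_def)
  next
    case (Cons i I)
    have "(LINT x|lborel. \<phi> x * partial_derivs (i # I) \<psi> x)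
        = - (LINT x|lborel. partial_deriv i \<phi> x * partial_derivs I \<psi> x)"
      using integral_by_parts[OF test_imp_C1c[OF Cons.prems(1)]
          test_imp_C1c[OF test_partial_derivs[OF Cons.prems(2)]], of i I]
      by (simp add: partial_derivs_def)
    also have "\<dots> = - ((-1) ^ length I * (LINT x|lborel. partial_derivs (rev I) (partial_deriv i \<phi>) x * \<psi> x))"
      using Cons.IH[OF test_partial_deriv[OF Cons.prems(1)] Cons.prems(2)] by simp
    finally show ?case by (simp add: partial_derivs_def)
  qed
  show ?thesis
    unfolding has_weak_deriv_def
  proof (intro conjI ballI)
    show "locally_integrable \<Omega> \<phi>" "locally_integrable \<Omega> (partial_derivs (rev I) \<phi>)"
      by (intro C0c_locally_integrable test_imp_C0c test_partial_derivs \<phi>)+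
    fix \<psi> assume \<psi>: "\<psi> \<in> test_functions \<Omega>"
    have "(\<lambda>x. \<phi> x * partial_derivs I \<psi> x) \<in> C0c \<Omega>" "(\<lambda>x. partial_derivs (rev I) \<phi> x * \<psi> x) \<in> C0c \<Omega>"
      by (intro C0c_mult test_imp_C0c test_partial_derivs \<phi> \<psi>)+
    then show "(LINT x|lebesgue_on \<Omega>. \<phi> x * partial_derivs I \<psi> x)
        = (-1) ^ length I * (LINT x|lebesgue_on \<Omega>. partial_derivs (rev I) \<phi> x * \<psi> x)"
      using ibp[OF \<phi> \<psi>] by (simp add: C0c_integral_lebesgue_on[OF _ \<Omega>l])
  qed
qed

text \<open>Measurability transfers along almost everywhere equality because Lebesgue measure is complete.\<close>

lemma L2_space_AE:
  assumes f: "f \<in> L2_space \<Omega>" and ae: "AE x in lebesgue_on \<Omega>. f x = g x" and \<Omega>: "\<Omega> \<in> sets lebesgue"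
  shows "g \<in> L2_space \<Omega>"
proof -
  have "(\<lambda>x. if x \<in> \<Omega> then f x else 0) \<in> borel_measurable lebesgue"
    using f \<Omega> by (simp add: L2_space_def borel_measurable_if)
  moreover have "AE x in lebesgue. (if x \<in> \<Omega> then f x else 0) = (if x \<in> \<Omega> then g x else 0)"
    using ae \<Omega> by (subst (asm) AE_restrict_space_iff) (auto elim: eventually_mono)
  ultimately have "(\<lambda>x. if x \<in> \<Omega> then g x else 0) \<in> borel_measurable lebesgue"
    by (rule borel_measurable_AE)
  then have g: "g \<in> borel_measurable (lebesgue_on \<Omega>)"
    using \<Omega> by (simp add: borel_measurable_if)
  have "integrable (lebesgue_on \<Omega>) (\<lambda>x. (f x)\<^sup>2) \<longleftrightarrow> integrable (lebesgue_on \<Omega>) (\<lambda>x. (g x)\<^sup>2)"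
    by (rule integrable_cong_AE) (use f g ae in \<open>auto simp: L2_space_def elim: eventually_mono\<close>)
  then show ?thesis using f g by (simp add: L2_space_def)
qed

lemma power2_add_le: "(s + t)\<^sup>2 \<le> 2 * s\<^sup>2 + 2 * t\<^sup>2" for s t :: real
proof -
  have "2 * s\<^sup>2 + 2 * t\<^sup>2 - (s + t)\<^sup>2 = (s - t)\<^sup>2" by algebra
  then show ?thesis by (metis diff_ge_0_iff_ge zero_le_power2)
qed

lemma L2_space_add:
  assumes "f \<in> L2_space \<Omega>" "g \<in> L2_space \<Omega>"
  shows "(\<lambda>x. f x + g x) \<in> L2_space \<Omega>"
proof -
  have "integrable (lebesgue_on \<Omega>) (\<lambda>x. (f x + g x)\<^sup>2)"
  proof (rule Bochner_Integration.integrable_bound)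
    show "integrable (lebesgue_on \<Omega>) (\<lambda>x. 2 * (f x)\<^sup>2 + 2 * (g x)\<^sup>2)"
      using assms by (simp add: L2_space_def)
    show "AE x in lebesgue_on \<Omega>. norm ((f x + g x)\<^sup>2) \<le> norm (2 * (f x)\<^sup>2 + 2 * (g x)\<^sup>2)"
      by (rule AE_I2) (simp add: power2_add_le)
  qed (use assms in \<open>auto simp: L2_space_def\<close>)
  then show ?thesis using assms by (auto simp: L2_space_def)
qed

lemma L2_add_le:
  assumes "f \<in> L2_space \<Omega>" "g \<in> L2_space \<Omega>"
  shows "(LINT x|lebesgue_on \<Omega>. (f x + g x)\<^sup>2)
    \<le> 2 * (LINT x|lebesgue_on \<Omega>. (f x)\<^sup>2) + 2 * (LINT x|lebesgue_on \<Omega>. (g x)\<^sup>2)"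
proof -
  have "(LINT x|lebesgue_on \<Omega>. (f x + g x)\<^sup>2) \<le> (LINT x|lebesgue_on \<Omega>. 2 * (f x)\<^sup>2 + 2 * (g x)\<^sup>2)"
  proof (rule integral_mono)
    show "integrable (lebesgue_on \<Omega>) (\<lambda>x. (f x + g x)\<^sup>2)"
      using L2_space_add[OF assms] by (simp add: L2_space_def)
    show "(f x + g x)\<^sup>2 \<le> 2 * (f x)\<^sup>2 + 2 * (g x)\<^sup>2" for x by (rule power2_add_le)
  qed (use assms in \<open>simp add: L2_space_def\<close>)
  then show ?thesis using assms by (simp add: L2_space_def)
qed

lemma L2_space_weight_mult:
  assumes f: "f \<in> L2_space \<Omega>" and \<Omega>: "open \<Omega>" and h: "continuous_on \<Omega> h"
    and B: "\<And>x. x \<in> \<Omega> \<Longrightarrow> \<bar>h x\<bar> \<le> B"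
  shows "(\<lambda>x. h x * f x) \<in> L2_space \<Omega>"
    and "(LINT x|lebesgue_on \<Omega>. (h x * f x)\<^sup>2) \<le> B\<^sup>2 * (LINT x|lebesgue_on \<Omega>. (f x)\<^sup>2)"
proof -
  have "h \<in> borel_measurable (lebesgue_on \<Omega>)"
    using \<Omega> h by (intro continuous_imp_measurable_on_sets_lebesgue) auto
  then have m: "(\<lambda>x. h x * f x) \<in> borel_measurable (lebesgue_on \<Omega>)"
    using f by (intro borel_measurable_times) (simp_all add: L2_space_def)
  have le: "(h x * f x)\<^sup>2 \<le> B\<^sup>2 * (f x)\<^sup>2" if "x \<in> \<Omega>" for x
  proof -
    have "(h x)\<^sup>2 \<le> B\<^sup>2" using B[OF that] abs_le_square_iff[of "h x" B] by simp
    then show ?thesis by (simp add: power_mult_distrib mult_right_mono)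
  qed
  have i: "integrable (lebesgue_on \<Omega>) (\<lambda>x. B\<^sup>2 * (f x)\<^sup>2)"
    using f by (simp add: L2_space_def)
  have j: "integrable (lebesgue_on \<Omega>) (\<lambda>x. (h x * f x)\<^sup>2)"
    by (rule Bochner_Integration.integrable_bound[OF i]) (use m le in auto)
  then show "(\<lambda>x. h x * f x) \<in> L2_space \<Omega>"
    using m by (simp add: L2_space_def)
  have "(LINT x|lebesgue_on \<Omega>. (h x * f x)\<^sup>2) \<le> (LINT x|lebesgue_on \<Omega>. B\<^sup>2 * (f x)\<^sup>2)"
    by (rule integral_mono[OF j i]) (use le in auto)
  then show "(LINT x|lebesgue_on \<Omega>. (h x * f x)\<^sup>2) \<le> B\<^sup>2 * (LINT x|lebesgue_on \<Omega>. (f x)\<^sup>2)"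
    by simp
qed

lemma L2_space_cmult: "f \<in> L2_space \<Omega> \<Longrightarrow> (\<lambda>x. c * f x) \<in> L2_space \<Omega>"
  by (auto simp: L2_space_def power_mult_distrib)

lemma L2_space_diff: "f \<in> L2_space \<Omega> \<Longrightarrow> g \<in> L2_space \<Omega> \<Longrightarrow> (\<lambda>x. f x - g x) \<in> L2_space \<Omega>"
  using L2_space_add[OF _ L2_space_cmult[of g \<Omega> "-1"], of f] by simp

lemma C0c_L2_space:
  assumes f: "f \<in> C0c \<Omega>" and \<Omega>: "\<Omega> \<in> sets lebesgue"
  shows "f \<in> L2_space \<Omega>"
  using C0c_integrable_lebesgue_on[OF f \<Omega>] C0c_integrable_lebesgue_on[OF C0c_power2[OF f] \<Omega>]
  by (auto simp: L2_space_def)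

text \<open>A substitute for the triangle inequality that stays with squares: the factor in front of the
  dominant term is arbitrarily close to one.\<close>

lemma L2_diff_le:
  assumes f: "f \<in> L2_space \<Omega>" and g: "g \<in> L2_space \<Omega>" and \<delta>: "0 < \<delta>"
    and h: "AE x in lebesgue_on \<Omega>. h x = f x - g x" and \<Omega>: "\<Omega> \<in> sets lebesgue"
  shows "(LINT x|lebesgue_on \<Omega>. (h x)\<^sup>2)
    \<le> (1 + \<delta>) * (LINT x|lebesgue_on \<Omega>. (f x)\<^sup>2) + (1 + 1 / \<delta>) * (LINT x|lebesgue_on \<Omega>. (g x)\<^sup>2)"
proof -
  have fg: "(\<lambda>x. f x - g x) \<in> L2_space \<Omega>" by (rule L2_space_diff[OF f g])
  have hL: "h \<in> L2_space \<Omega>"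
    by (rule L2_space_AE[OF fg _ \<Omega>]) (use h in \<open>auto elim: eventually_mono\<close>)
  have le: "(f x - g x)\<^sup>2 \<le> (1 + \<delta>) * (f x)\<^sup>2 + (1 + 1 / \<delta>) * (g x)\<^sup>2" for x
  proof -
    have "(1 + \<delta>) * (f x)\<^sup>2 + (1 + 1 / \<delta>) * (g x)\<^sup>2 - (f x - g x)\<^sup>2 = (\<delta> * f x + g x)\<^sup>2 / \<delta>"
      using \<delta> by (simp add: field_simps power2_eq_square)
    moreover have "0 \<le> (\<delta> * f x + g x)\<^sup>2 / \<delta>" using \<delta> by simp
    ultimately show ?thesis by linarith
  qed
  have "(LINT x|lebesgue_on \<Omega>. (h x)\<^sup>2) \<le> (LINT x|lebesgue_on \<Omega>. (1 + \<delta>) * (f x)\<^sup>2 + (1 + 1 / \<delta>) * (g x)\<^sup>2)"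
  proof (rule integral_mono_AE)
    show "AE x in lebesgue_on \<Omega>. (h x)\<^sup>2 \<le> (1 + \<delta>) * (f x)\<^sup>2 + (1 + 1 / \<delta>) * (g x)\<^sup>2"
      using h by eventually_elim (use le in simp)
  qed (use f g hL in \<open>auto simp: L2_space_def\<close>)
  also have "\<dots> = (1 + \<delta>) * (LINT x|lebesgue_on \<Omega>. (f x)\<^sup>2) + (1 + 1 / \<delta>) * (LINT x|lebesgue_on \<Omega>. (g x)\<^sup>2)"
    using f g by (simp add: L2_space_def)
  finally show ?thesis .
qed

lemma
  assumes u: "u \<in> sobolev_space n \<Omega>" and I: "length I \<le> n" and \<Omega>: "open \<Omega>"
  shows has_weak_deriv_weak_deriv: "has_weak_deriv \<Omega> I u (weak_deriv \<Omega> I u)"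
    and weak_deriv_L2: "weak_deriv \<Omega> I u \<in> L2_space \<Omega>"
proof -
  obtain g where g: "g \<in> L2_space \<Omega>" "has_weak_deriv \<Omega> I u g"
    using u I by (auto simp: sobolev_space_def)
  show w: "has_weak_deriv \<Omega> I u (weak_deriv \<Omega> I u)"
    unfolding weak_deriv_def by (rule someI[of _ g]) (rule g(2))
  show "weak_deriv \<Omega> I u \<in> L2_space \<Omega>"
    by (rule L2_space_AE[OF g(1) has_weak_deriv_unique[OF g(2) w \<Omega>]]) (use \<Omega> in auto)
qed

lemma sobolev_space_minus_test:
  assumes u: "u \<in> sobolev_space n \<Omega>" and \<phi>: "\<phi> \<in> test_functions \<Omega>" and \<Omega>: "open \<Omega>"
  shows "(\<lambda>x. u x - \<phi> x) \<in> sobolev_space n \<Omega>"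
proof -
  have \<Omega>l: "\<Omega> \<in> sets lebesgue" using \<Omega> by auto
  have "\<exists>g\<in>L2_space \<Omega>. has_weak_deriv \<Omega> I (\<lambda>x. u x - \<phi> x) g" if I: "length I \<le> n" for I
  proof (rule bexI)
    show "has_weak_deriv \<Omega> I (\<lambda>x. u x - \<phi> x) (\<lambda>x. weak_deriv \<Omega> I u x - partial_derivs (rev I) \<phi> x)"
      by (intro has_weak_deriv_diff has_weak_deriv_weak_deriv[OF u I \<Omega>] test_has_weak_deriv \<phi> \<Omega>)
    show "(\<lambda>x. weak_deriv \<Omega> I u x - partial_derivs (rev I) \<phi> x) \<in> L2_space \<Omega>"
      by (intro L2_space_diff weak_deriv_L2[OF u I \<Omega>] C0c_L2_space[OF _ \<Omega>l] test_imp_C0c test_partial_derivs \<phi>)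
  qed
  moreover have "(\<lambda>x. u x - \<phi> x) \<in> L2_space \<Omega>"
    using u by (intro L2_space_diff[OF _ C0c_L2_space[OF test_imp_C0c[OF \<phi>] \<Omega>l]])
      (simp add: sobolev_space_def)
  ultimately show ?thesis by (simp add: sobolev_space_def)
qed

lemma weak_deriv_minus_test:
  assumes u: "u \<in> sobolev_space n \<Omega>" and \<phi>: "\<phi> \<in> test_functions \<Omega>" and \<Omega>: "open \<Omega>" and I: "length I \<le> n"
  shows "AE x in lebesgue_on \<Omega>. weak_deriv \<Omega> I (\<lambda>x. u x - \<phi> x) x = weak_deriv \<Omega> I u x - partial_derivs (rev I) \<phi> x"
  by (rule has_weak_deriv_unique[OF
        has_weak_deriv_weak_deriv[OF sobolev_space_minus_test[OF u \<phi> \<Omega>] I \<Omega>]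
        has_weak_deriv_diff[OF has_weak_deriv_weak_deriv[OF u I \<Omega>] test_has_weak_deriv[OF \<phi> \<Omega>] \<Omega>] \<Omega>])

lemma weak_deriv_le_sobolev_norm:
  assumes "length I \<le> n"
  shows "(LINT x|lebesgue_on \<Omega>. (weak_deriv \<Omega> I u x)\<^sup>2) \<le> (sobolev_norm n \<Omega> u)\<^sup>2"
proof -
  have nn: "0 \<le> (LINT x|lebesgue_on \<Omega>. (weak_deriv \<Omega> I u x)\<^sup>2)" for I
    by (intro Bochner_Integration.integral_nonneg) auto
  have "finite {I :: 'a list. length I \<le> n}"
    using finite_lists_length_le[of "UNIV :: 'a set" n] by simp
  then have "(LINT x|lebesgue_on \<Omega>. (weak_deriv \<Omega> I u x)\<^sup>2)
      \<le> (\<Sum>I | length I \<le> n. LINT x|lebesgue_on \<Omega>. (weak_deriv \<Omega> I u x)\<^sup>2)"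
    using assms nn by (intro member_le_sum) auto
  also have "\<dots> = (sobolev_norm n \<Omega> u)\<^sup>2"
    unfolding sobolev_norm_def by (simp add: sum_nonneg nn)
  finally show ?thesis .
qed

section \<open>Passage from test functions to Sobolev functions\<close>

text \<open>The operator \<open>|x|\<^sup>1\<^sup>-\<^sup>m \<Delta> |x|\<^sup>m\<^sup>-\<^sup>1\<close> written out in terms of the Laplacian \<open>w\<close>, the partial derivatives
  \<open>g\<^sub>1\<close>, \<open>g\<^sub>2\<close> and the values of a function. As separate arguments, these may be classical or weak
  derivatives.\<close>

definition conj_laplacian ::
  "real \<Rightarrow> (real^2 \<Rightarrow> real) \<Rightarrow> (real^2 \<Rightarrow> real) \<Rightarrow> (real^2 \<Rightarrow> real) \<Rightarrow> (real^2 \<Rightarrow> real) \<Rightarrow> real^2 \<Rightarrow> real" where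
  "conj_laplacian m w g\<^sub>1 g\<^sub>2 u x = w x + (2 * (m - 1) * x $ 1 / (norm x)\<^sup>2 * g\<^sub>1 x
    + (2 * (m - 1) * x $ 2 / (norm x)\<^sup>2 * g\<^sub>2 x + (m - 1)\<^sup>2 / (norm x)\<^sup>2 * u x))"

context annulus
begin

lemma open_\<Omega>: "open \<Omega>" and \<Omega>_sets: "\<Omega> \<in> sets lebesgue"
proof -
  show "open \<Omega>" by (rule open_dom)
  then show "\<Omega> \<in> sets lebesgue" by auto
qed

lemma coefficient_bounds:
  shows "continuous_on \<Omega> (\<lambda>x. c * x $ i / (norm x)\<^sup>2)"
    and "continuous_on \<Omega> (\<lambda>x. c / (norm x)\<^sup>2)"
    and "x \<in> \<Omega> \<Longrightarrow> \<bar>c * x $ i / (norm x)\<^sup>2\<bar> \<le> \<bar>c\<bar> / a"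
    and "x \<in> \<Omega> \<Longrightarrow> \<bar>c / (norm x)\<^sup>2\<bar> \<le> \<bar>c\<bar> / a\<^sup>2"
proof -
  show "continuous_on \<Omega> (\<lambda>x. c * x $ i / (norm x)\<^sup>2)" "continuous_on \<Omega> (\<lambda>x. c / (norm x)\<^sup>2)"
    using a_pos by (auto intro!: continuous_intros)
  assume x: "x \<in> \<Omega>"
  then have n: "a < norm x" by simp
  have "\<bar>c * x $ i / (norm x)\<^sup>2\<bar> = \<bar>c\<bar> * (\<bar>x $ i\<bar> / norm x) / norm x"
    by (simp add: abs_mult power2_eq_square)
  also have "\<dots> \<le> \<bar>c\<bar> * 1 / norm x"
  proof (intro divide_right_mono mult_left_mono)
    have "0 < norm x" using n a_pos by linarith
    then show "\<bar>x $ i\<bar> / norm x \<le> 1"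
      using component_le_norm_cart[of x i] by (simp add: divide_le_eq_1)
  qed auto
  also have "\<dots> \<le> \<bar>c\<bar> / a"
    using n a_pos by (simp add: frac_le)
  finally show "\<bar>c * x $ i / (norm x)\<^sup>2\<bar> \<le> \<bar>c\<bar> / a" .
  have "a\<^sup>2 \<le> (norm x)\<^sup>2" using n a_pos by (intro power_mono) auto
  then have "\<bar>c\<bar> / (norm x)\<^sup>2 \<le> \<bar>c\<bar> / a\<^sup>2"
    using n a_pos by (intro divide_left_mono mult_pos_pos) auto
  then show "\<bar>c / (norm x)\<^sup>2\<bar> \<le> \<bar>c\<bar> / a\<^sup>2" by (simp add: abs_divide)
qed

text \<open>The bound \<open>4 \<eta>\<close> for the Laplacian allows for its being a sum of two second derivatives, each with
  integrated square at most \<open>\<eta>\<close>.\<close>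

lemma
  assumes L: "w \<in> L2_space \<Omega>" "g\<^sub>1 \<in> L2_space \<Omega>" "g\<^sub>2 \<in> L2_space \<Omega>" "u \<in> L2_space \<Omega>"
  shows conj_laplacian_L2: "conj_laplacian m w g\<^sub>1 g\<^sub>2 u \<in> L2_space \<Omega>"
    and conj_laplacian_bound: "\<lbrakk>(LINT x|lebesgue_on \<Omega>. (w x)\<^sup>2) \<le> 4 * \<eta>; (LINT x|lebesgue_on \<Omega>. (g\<^sub>1 x)\<^sup>2) \<le> \<eta>;
        (LINT x|lebesgue_on \<Omega>. (g\<^sub>2 x)\<^sup>2) \<le> \<eta>; (LINT x|lebesgue_on \<Omega>. (u x)\<^sup>2) \<le> \<eta>\<rbrakk>
      \<Longrightarrow> (LINT x|lebesgue_on \<Omega>. (conj_laplacian m w g\<^sub>1 g\<^sub>2 u x)\<^sup>2)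
        \<le> (8 + 12 * (\<bar>2 * (m - 1)\<bar> / a)\<^sup>2 + 8 * (\<bar>(m - 1)\<^sup>2\<bar> / a\<^sup>2)\<^sup>2) * \<eta>"
proof -
  let ?c = "2 * (m - 1)"
  let ?B = "\<bar>?c\<bar> / a" and ?D = "\<bar>(m - 1)\<^sup>2\<bar> / a\<^sup>2"
  define p where "p = (\<lambda>x. ?c * x $ 1 / (norm x)\<^sup>2 * g\<^sub>1 x)"
  define q where "q = (\<lambda>x. ?c * x $ 2 / (norm x)\<^sup>2 * g\<^sub>2 x)"
  define r where "r = (\<lambda>x. (m - 1)\<^sup>2 / (norm x)\<^sup>2 * u x)"
  have P: "p \<in> L2_space \<Omega>" "(LINT x|lebesgue_on \<Omega>. (p x)\<^sup>2) \<le> ?B\<^sup>2 * (LINT x|lebesgue_on \<Omega>. (g\<^sub>1 x)\<^sup>2)"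
    using L2_space_weight_mult[OF L(2) open_\<Omega> coefficient_bounds(1,3)[where c = ?c and i = 1]]
    unfolding p_def by blast+
  have Q: "q \<in> L2_space \<Omega>" "(LINT x|lebesgue_on \<Omega>. (q x)\<^sup>2) \<le> ?B\<^sup>2 * (LINT x|lebesgue_on \<Omega>. (g\<^sub>2 x)\<^sup>2)"
    using L2_space_weight_mult[OF L(3) open_\<Omega> coefficient_bounds(1,3)[where c = ?c and i = 2]]
    unfolding q_def by blast+
  have R: "r \<in> L2_space \<Omega>" "(LINT x|lebesgue_on \<Omega>. (r x)\<^sup>2) \<le> ?D\<^sup>2 * (LINT x|lebesgue_on \<Omega>. (u x)\<^sup>2)"
    using L2_space_weight_mult[OF L(4) open_\<Omega> coefficient_bounds(2,4)[where c = "(m - 1)\<^sup>2"]]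
    unfolding r_def by blast+
  note qr = L2_space_add[OF Q(1) R(1)] and pqr = L2_space_add[OF P(1) L2_space_add[OF Q(1) R(1)]]
  have op: "conj_laplacian m w g\<^sub>1 g\<^sub>2 u = (\<lambda>x. w x + (p x + (q x + r x)))"
    by (simp add: conj_laplacian_def[abs_def] p_def q_def r_def)
  show "conj_laplacian m w g\<^sub>1 g\<^sub>2 u \<in> L2_space \<Omega>"
    unfolding op by (rule L2_space_add[OF L(1) pqr])
  define I where "I f = (LINT x|lebesgue_on \<Omega>. (f x)\<^sup>2)" for f :: "real^2 \<Rightarrow> real"
  assume "(LINT x|lebesgue_on \<Omega>. (w x)\<^sup>2) \<le> 4 * \<eta>" "(LINT x|lebesgue_on \<Omega>. (g\<^sub>1 x)\<^sup>2) \<le> \<eta>"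
    "(LINT x|lebesgue_on \<Omega>. (g\<^sub>2 x)\<^sup>2) \<le> \<eta>" "(LINT x|lebesgue_on \<Omega>. (u x)\<^sup>2) \<le> \<eta>"
  then have w: "I w \<le> 4 * \<eta>" and "?B\<^sup>2 * I g\<^sub>1 \<le> ?B\<^sup>2 * \<eta>" "?B\<^sup>2 * I g\<^sub>2 \<le> ?B\<^sup>2 * \<eta>" "?D\<^sup>2 * I u \<le> ?D\<^sup>2 * \<eta>"
    unfolding I_def by (auto intro!: mult_left_mono)
  moreover have "I p \<le> ?B\<^sup>2 * I g\<^sub>1" "I q \<le> ?B\<^sup>2 * I g\<^sub>2" "I r \<le> ?D\<^sup>2 * I u"
    unfolding I_def using P(2) Q(2) R(2) by blast+
  ultimately have "I p \<le> ?B\<^sup>2 * \<eta>" "I q \<le> ?B\<^sup>2 * \<eta>" "I r \<le> ?D\<^sup>2 * \<eta>" by linarith+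
  moreover have "I (\<lambda>x. w x + (p x + (q x + r x))) \<le> 2 * I w + 2 * I (\<lambda>x. p x + (q x + r x))"
    "I (\<lambda>x. p x + (q x + r x)) \<le> 2 * I p + 2 * I (\<lambda>x. q x + r x)"
    "I (\<lambda>x. q x + r x) \<le> 2 * I q + 2 * I r"
    unfolding I_def using L2_add_le[OF L(1) pqr] L2_add_le[OF P(1) qr] L2_add_le[OF Q(1) R(1)]
    by blast+
  moreover define \<beta> \<gamma> where "\<beta> = ?B\<^sup>2" and "\<gamma> = ?D\<^sup>2"
  ultimately have "I (\<lambda>x. w x + (p x + (q x + r x))) \<le> (8 + 12 * \<beta> + 8 * \<gamma>) * \<eta>"
    using w by (simp only: distrib_right mult.assoc)
  then show "(LINT x|lebesgue_on \<Omega>. (conj_laplacian m w g\<^sub>1 g\<^sub>2 u x)\<^sup>2) \<le> (8 + 12 * ?B\<^sup>2 + 8 * ?D\<^sup>2) * \<eta>"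
    unfolding I_def op \<beta>_def \<gamma>_def .
qed

text \<open>On test functions \<open>|x|\<^sup>2\<close> times the operator is \<open>(T + m)\<^sup>2 + S\<^sup>2\<close>, with \<open>T\<close> and \<open>S\<close> the radial and
  angular operator.\<close>

lemma conj_laplacian_test_inequality:
  assumes \<phi>: "\<phi> \<in> test_functions \<Omega>"
  shows "(4 * m\<^sup>2 + freq\<^sup>2) * freq\<^sup>2 * (LINT x|lebesgue_on \<Omega>. (1 / (norm x)\<^sup>2 * \<phi> x)\<^sup>2)
    \<le> (LINT x|lebesgue_on \<Omega>. (conj_laplacian m (\<lambda>x. partial_deriv 1 (partial_deriv 1 \<phi>) x + partial_deriv 2 (partial_deriv 2 \<phi>) x)
          (partial_deriv 1 \<phi>) (partial_deriv 2 \<phi>) \<phi> x)\<^sup>2)"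
proof -
  define T where "T x = radial_D (radial_D \<phi>) x + 2 * m * radial_D \<phi> x + m\<^sup>2 * \<phi> x + angular_D (angular_D \<phi>) x" for x
  have c: "continuous_on \<Omega> (\<lambda>x. 1 / (norm x) ^ 4)"
    using a_pos by (auto intro!: continuous_intros)
  have "T \<in> C0c \<Omega>"
    unfolding T_def[abs_def]
    by (intro C0c_add C0c_cmult test_imp_C0c radial_D_test angular_D_test \<phi>)
  note T = C0c_integral_lebesgue_on[OF C0c_weight_mult[OF open_\<Omega> c C0c_power2[OF this]] \<Omega>_sets]
  note f = C0c_integral_lebesgue_on[OF C0c_weight_mult[OF open_\<Omega> c C0c_power2[OF test_imp_C0c[OF \<phi>]]] \<Omega>_sets]
  have "(LINT x|lebesgue_on \<Omega>. (1 / (norm x)\<^sup>2 * \<phi> x)\<^sup>2) = wint (\<lambda>x. (\<phi> x)\<^sup>2)"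
    using f by (simp add: wint_def power_mult_distrib power_divide flip: power_mult)
  moreover have "(LINT x|lebesgue_on \<Omega>. (conj_laplacian m (\<lambda>x. partial_deriv 1 (partial_deriv 1 \<phi>) x + partial_deriv 2 (partial_deriv 2 \<phi>) x)
          (partial_deriv 1 \<phi>) (partial_deriv 2 \<phi>) \<phi> x)\<^sup>2) = (LINT x|lebesgue_on \<Omega>. 1 / (norm x) ^ 4 * (T x)\<^sup>2)"
  proof (rule Bochner_Integration.integral_cong)
    fix x assume "x \<in> space (lebesgue_on \<Omega>)"
    then have n: "(norm x)\<^sup>2 \<noteq> 0" using a_pos by auto
    let ?\<Delta> = "partial_deriv 1 (partial_deriv 1 \<phi>) x + partial_deriv 2 (partial_deriv 2 \<phi>) x"
    have "(norm x)\<^sup>2 * conj_laplacian m (\<lambda>x. partial_deriv 1 (partial_deriv 1 \<phi>) x + partial_deriv 2 (partial_deriv 2 \<phi>) x)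
          (partial_deriv 1 \<phi>) (partial_deriv 2 \<phi>) \<phi> x
       = (norm x)\<^sup>2 * ?\<Delta> + 2 * (m - 1) * (x $ 1 * partial_deriv 1 \<phi> x + x $ 2 * partial_deriv 2 \<phi> x) + (m - 1)\<^sup>2 * \<phi> x"
      using n by (simp add: conj_laplacian_def field_simps)
    also have "\<dots> = T x"
      unfolding laplacian_radial_angular[OF test_smooth[OF \<phi>], symmetric] T_def
      by (simp add: radial_D_def[of \<phi> x] algebra_simps power2_eq_square)
    finally have "conj_laplacian m (\<lambda>x. partial_deriv 1 (partial_deriv 1 \<phi>) x + partial_deriv 2 (partial_deriv 2 \<phi>) x)
          (partial_deriv 1 \<phi>) (partial_deriv 2 \<phi>) \<phi> x = T x / (norm x)\<^sup>2"
      using n by (simp add: eq_divide_eq mult.commute)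
    then show "(conj_laplacian m (\<lambda>x. partial_deriv 1 (partial_deriv 1 \<phi>) x + partial_deriv 2 (partial_deriv 2 \<phi>) x)
          (partial_deriv 1 \<phi>) (partial_deriv 2 \<phi>) \<phi> x)\<^sup>2 = 1 / (norm x) ^ 4 * (T x)\<^sup>2"
      by (simp add: power_divide flip: power_mult)
  qed simp
  ultimately show ?thesis
    using test_function_inequality[OF \<phi>, of m] T by (simp add: wint_def T_def)
qed

text \<open>Approximate \<open>u\<close> by a test function \<open>\<phi>\<close> with \<open>\<parallel>u - \<phi>\<parallel>\<^sup>2 < \<eta>\<close>. Passing from \<open>u\<close> to \<open>\<phi>\<close> on either side
  costs a factor \<open>1 + \<delta>\<close> and an error of order \<open>\<eta>\<close> with a constant depending on \<open>\<delta>\<close>, so the limit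
  is taken first in \<open>\<eta>\<close> and then in \<open>\<delta>\<close>.\<close>

lemma sobolev_inequality:
  assumes u: "u \<in> sobolev_space_0 2 \<Omega>"
  shows "(4 * m\<^sup>2 + freq\<^sup>2) * freq\<^sup>2 * (LINT x|lebesgue_on \<Omega>. (1 / (norm x)\<^sup>2 * u x)\<^sup>2)
    \<le> (LINT x|lebesgue_on \<Omega>. (conj_laplacian m (\<lambda>x. weak_deriv \<Omega> [1, 1] u x + weak_deriv \<Omega> [2, 2] u x)
          (weak_deriv \<Omega> [1] u) (weak_deriv \<Omega> [2] u) u x)\<^sup>2)"
proof -
  define \<Lambda> where "\<Lambda> = (4 * m\<^sup>2 + freq\<^sup>2) * freq\<^sup>2"
  define F where "F u = conj_laplacian m (\<lambda>x. weak_deriv \<Omega> [1, 1] u x + weak_deriv \<Omega> [2, 2] u x)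
          (weak_deriv \<Omega> [1] u) (weak_deriv \<Omega> [2] u) u" for u
  define A where "A = (LINT x|lebesgue_on \<Omega>. (1 / (norm x)\<^sup>2 * u x)\<^sup>2)"
  define B where "B = (LINT x|lebesgue_on \<Omega>. (F u x)\<^sup>2)"
  define C where "C = 8 + 12 * (\<bar>2 * (m - 1)\<bar> / a)\<^sup>2 + 8 * (\<bar>(m - 1)\<^sup>2\<bar> / a\<^sup>2)\<^sup>2"
  have \<Lambda>: "0 \<le> \<Lambda>" by (simp add: \<Lambda>_def)
  have B: "0 \<le> B" unfolding B_def by (intro Bochner_Integration.integral_nonneg) auto
  have us: "u \<in> sobolev_space 2 \<Omega>" using u by (simp add: sobolev_space_0_def)
  have L2: "v \<in> L2_space \<Omega>" "weak_deriv \<Omega> [i] v \<in> L2_space \<Omega>"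
    "(\<lambda>x. weak_deriv \<Omega> [1, 1] v x + weak_deriv \<Omega> [2, 2] v x) \<in> L2_space \<Omega>"
    if v: "v \<in> sobolev_space 2 \<Omega>" for v i
  proof -
    show "v \<in> L2_space \<Omega>" using v by (simp add: sobolev_space_def)
    show "weak_deriv \<Omega> [i] v \<in> L2_space \<Omega>" by (rule weak_deriv_L2[OF v _ open_\<Omega>]) simp
    show "(\<lambda>x. weak_deriv \<Omega> [1, 1] v x + weak_deriv \<Omega> [2, 2] v x) \<in> L2_space \<Omega>"
      by (intro L2_space_add weak_deriv_L2[OF v _ open_\<Omega>]) simp_all
  qed
  have FL2: "F v \<in> L2_space \<Omega>" if "v \<in> sobolev_space 2 \<Omega>" for v
    unfolding F_def by (intro conj_laplacian_L2 L2 that)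
  have wL2: "(\<lambda>x. 1 / (norm x)\<^sup>2 * v x) \<in> L2_space \<Omega>"
    and wle: "(LINT x|lebesgue_on \<Omega>. (1 / (norm x)\<^sup>2 * v x)\<^sup>2) \<le> (1 / a\<^sup>2)\<^sup>2 * (LINT x|lebesgue_on \<Omega>. (v x)\<^sup>2)"
    if "v \<in> L2_space \<Omega>" for v
    using L2_space_weight_mult[OF that open_\<Omega> coefficient_bounds(2,4)[where c = 1]] by simp_all
  have approx: "\<Lambda> * A \<le> (1 + \<delta>)\<^sup>2 * B + ((1 + \<delta>) * (1 + 1 / \<delta>) * C + \<Lambda> * (1 + 1 / \<delta>) * (1 / a\<^sup>2)\<^sup>2) * \<eta>"
    if \<delta>: "0 < \<delta>" and \<eta>: "0 < \<eta>" for \<delta> \<eta>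
  proof -
    obtain \<phi> where \<phi>: "\<phi> \<in> test_functions \<Omega>" and "sobolev_norm 2 \<Omega> (\<lambda>x. u x - \<phi> x) < sqrt \<eta>"
    proof -
      have "\<forall>\<epsilon>>0. \<exists>\<phi>\<in>test_functions \<Omega>. sobolev_norm 2 \<Omega> (\<lambda>x. u x - \<phi> x) < \<epsilon>"
        using u by (simp add: sobolev_space_0_def)
      moreover have "0 < sqrt \<eta>" using \<eta> by simp
      ultimately show thesis using that by blast
    qed
    define v where "v x = u x - \<phi> x" for x
    have vs: "v \<in> sobolev_space 2 \<Omega>"
      unfolding v_def[abs_def] by (rule sobolev_space_minus_test[OF us \<phi> open_\<Omega>])
    have "0 \<le> sobolev_norm 2 \<Omega> v"
      unfolding sobolev_norm_def by (intro real_sqrt_ge_zero sum_nonneg Bochner_Integration.integral_nonneg) auto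
    then have "(sobolev_norm 2 \<Omega> v)\<^sup>2 \<le> (sqrt \<eta>)\<^sup>2"
      using \<open>sobolev_norm 2 \<Omega> (\<lambda>x. u x - \<phi> x) < sqrt \<eta>\<close>
      by (intro power_mono) (simp_all add: v_def[abs_def])
    then have small: "(LINT x|lebesgue_on \<Omega>. (weak_deriv \<Omega> I v x)\<^sup>2) \<le> \<eta>" if "length I \<le> 2" for I
      using weak_deriv_le_sobolev_norm[OF that, of \<Omega> v] \<eta> by simp
    have wd: "AE x in lebesgue_on \<Omega>. weak_deriv \<Omega> I v x = weak_deriv \<Omega> I u x - partial_derivs (rev I) \<phi> x"
      if "length I \<le> 2" for I
      unfolding v_def[abs_def] by (rule weak_deriv_minus_test[OF us \<phi> open_\<Omega> that])
    have "AE x in lebesgue_on \<Omega>. weak_deriv \<Omega> [] v x = v x"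
      by (rule has_weak_deriv_unique[OF has_weak_deriv_weak_deriv[OF vs _ open_\<Omega>] _ open_\<Omega>])
        (use has_weak_deriv_weak_deriv[OF vs, of "[]"] open_\<Omega> in \<open>simp_all add: has_weak_deriv_def partial_derivs_def\<close>)
    then have "(LINT x|lebesgue_on \<Omega>. (weak_deriv \<Omega> [] v x)\<^sup>2) = (LINT x|lebesgue_on \<Omega>. (v x)\<^sup>2)"
      using L2(1)[OF vs] weak_deriv_L2[OF vs, of "[]"] open_\<Omega>
      by (intro integral_cong_AE) (auto simp: L2_space_def elim: eventually_mono)
    then have v_small: "(LINT x|lebesgue_on \<Omega>. (v x)\<^sup>2) \<le> \<eta>"
      using small[of "[]"] by simp
    have "(LINT x|lebesgue_on \<Omega>. (weak_deriv \<Omega> [1, 1] v x + weak_deriv \<Omega> [2, 2] v x)\<^sup>2) \<le> 2 * \<eta> + 2 * \<eta>"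
      using L2_add_le[OF weak_deriv_L2[OF vs, of "[1, 1]"] weak_deriv_L2[OF vs, of "[2, 2]"]] open_\<Omega>
        small[of "[1, 1]"] small[of "[2, 2]"] by simp
    then have Fv: "(LINT x|lebesgue_on \<Omega>. (F v x)\<^sup>2) \<le> C * \<eta>"
      unfolding F_def C_def
      by (intro conj_laplacian_bound L2 vs small v_small) simp_all
    define G where "G = conj_laplacian m (\<lambda>x. partial_deriv 1 (partial_deriv 1 \<phi>) x + partial_deriv 2 (partial_deriv 2 \<phi>) x)
          (partial_deriv 1 \<phi>) (partial_deriv 2 \<phi>) \<phi>"
    have "AE x in lebesgue_on \<Omega>. G x = F u x - F v x"
      using wd[of "[1]", simplified] wd[of "[2]", simplified] wd[of "[1, 1]", simplified] wd[of "[2, 2]", simplified]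
    proof eventually_elim
      case (elim x)
      then show ?case
        by (simp add: G_def F_def conj_laplacian_def partial_derivs_def v_def right_diff_distrib)
    qed
    then have "(LINT x|lebesgue_on \<Omega>. (G x)\<^sup>2) \<le> (1 + \<delta>) * B + (1 + 1 / \<delta>) * (LINT x|lebesgue_on \<Omega>. (F v x)\<^sup>2)"
      unfolding B_def
      by (intro L2_diff_le \<delta> \<Omega>_sets FL2 us vs)
    also have "\<dots> \<le> (1 + \<delta>) * B + (1 + 1 / \<delta>) * (C * \<eta>)"
      using Fv \<delta> by (intro add_left_mono mult_left_mono) auto
    finally have "\<Lambda> * (LINT x|lebesgue_on \<Omega>. (1 / (norm x)\<^sup>2 * \<phi> x)\<^sup>2) \<le> (1 + \<delta>) * B + (1 + 1 / \<delta>) * (C * \<eta>)"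
      using conj_laplacian_test_inequality[OF \<phi>, of m] unfolding \<Lambda>_def G_def by linarith
    then have 1: "(1 + \<delta>) * (\<Lambda> * (LINT x|lebesgue_on \<Omega>. (1 / (norm x)\<^sup>2 * \<phi> x)\<^sup>2)) \<le> (1 + \<delta>) * ((1 + \<delta>) * B + (1 + 1 / \<delta>) * (C * \<eta>))"
      using \<delta> by (intro mult_left_mono) auto
    have \<phi>L: "\<phi> \<in> L2_space \<Omega>" by (intro C0c_L2_space test_imp_C0c \<phi> \<Omega>_sets)
    have "A \<le> (1 + \<delta>) * (LINT x|lebesgue_on \<Omega>. (1 / (norm x)\<^sup>2 * \<phi> x)\<^sup>2)
        + (1 + 1 / \<delta>) * (LINT x|lebesgue_on \<Omega>. (- (1 / (norm x)\<^sup>2 * v x))\<^sup>2)"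
      unfolding A_def
      using L2_space_cmult[OF wL2[OF L2(1)[OF vs]], of "-1"]
      by (intro L2_diff_le \<delta> \<Omega>_sets wL2 \<phi>L) (auto simp: v_def algebra_simps diff_divide_distrib)
    also have "\<dots> \<le> (1 + \<delta>) * (LINT x|lebesgue_on \<Omega>. (1 / (norm x)\<^sup>2 * \<phi> x)\<^sup>2)
        + (1 + 1 / \<delta>) * ((1 / a\<^sup>2)\<^sup>2 * \<eta>)"
    proof -
      have "(LINT x|lebesgue_on \<Omega>. (- (1 / (norm x)\<^sup>2 * v x))\<^sup>2) \<le> (1 / a\<^sup>2)\<^sup>2 * (LINT x|lebesgue_on \<Omega>. (v x)\<^sup>2)"
        using wle[OF L2(1)[OF vs]] by simp
      also have "\<dots> \<le> (1 / a\<^sup>2)\<^sup>2 * \<eta>" by (intro mult_left_mono v_small) simp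
      finally show ?thesis using \<delta> by (intro add_left_mono mult_left_mono) auto
    qed
    finally have "\<Lambda> * A \<le> \<Lambda> * ((1 + \<delta>) * (LINT x|lebesgue_on \<Omega>. (1 / (norm x)\<^sup>2 * \<phi> x)\<^sup>2)
        + (1 + 1 / \<delta>) * ((1 / a\<^sup>2)\<^sup>2 * \<eta>))"
      using \<Lambda> by (rule mult_left_mono)
    with 1 show ?thesis by (simp add: algebra_simps power2_eq_square)
  qed
  have "\<Lambda> * A \<le> (1 + \<delta>)\<^sup>2 * B" if \<delta>: "0 < \<delta>" for \<delta>
  proof (rule tendsto_lowerbound)
    show "((\<lambda>\<eta>. (1 + \<delta>)\<^sup>2 * B + ((1 + \<delta>) * (1 + 1 / \<delta>) * C + \<Lambda> * (1 + 1 / \<delta>) * (1 / a\<^sup>2)\<^sup>2) * \<eta>)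
        \<longlongrightarrow> (1 + \<delta>)\<^sup>2 * B) (at_right 0)"
      by (rule tendsto_eq_intros refl)+ simp
    show "\<forall>\<^sub>F \<eta> in at_right 0. \<Lambda> * A \<le> (1 + \<delta>)\<^sup>2 * B + ((1 + \<delta>) * (1 + 1 / \<delta>) * C + \<Lambda> * (1 + 1 / \<delta>) * (1 / a\<^sup>2)\<^sup>2) * \<eta>"
      using approx[OF \<delta>] by (auto simp: eventually_at_right_field intro!: exI[of _ 1])
  qed simp
  then have "\<forall>\<^sub>F \<delta> in at_right 0. \<Lambda> * A \<le> (1 + \<delta>)\<^sup>2 * B"
    by (auto simp: eventually_at_right_field intro!: exI[of _ 1])
  moreover have "((\<lambda>\<delta>. (1 + \<delta>)\<^sup>2 * B) \<longlongrightarrow> (1 + 0)\<^sup>2 * B) (at_right 0)"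
    by (intro tendsto_intros)
  ultimately have "\<Lambda> * A \<le> B"
    using tendsto_lowerbound[of "\<lambda>\<delta>. (1 + \<delta>)\<^sup>2 * B" "(1 + 0)\<^sup>2 * B" "at_right 0" "\<Lambda> * A"] by simp
  then show ?thesis by (simp add: \<Lambda>_def A_def B_def F_def)
qed

end

theorem corollary1p2:
  fixes m a b :: real and \<Omega> :: "(real^2) set" and u :: "real^2 \<Rightarrow> real"
  assumes "m \<ge> 1" and "0 < a" and "a < b"
    and "\<Omega> = ball 0 b - cball 0 a"
    and "ln (b / a) \<ge> pi * sqrt 2 / sqrt (2 * m - 1)"
    and "u \<in> sobolev_space_0 2 \<Omega>"
  shows "(LINT x|lebesgue_on \<Omega>.
            (weak_laplacian \<Omega> u x
              + 2 * (m - 1) * ((x /\<^sub>R (norm x)\<^sup>2) \<bullet> weak_gradient \<Omega> u x)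
              + (m - 1)\<^sup>2 / (norm x)\<^sup>2 * u x)\<^sup>2)
         \<ge> (4 * m\<^sup>2 + pi\<^sup>2 / (ln (b / a))\<^sup>2) * (pi\<^sup>2 / (ln (b / a))\<^sup>2)
            * (LINT x|lebesgue_on \<Omega>. (u x)\<^sup>2 / (norm x) ^ 4)"
proof -
  interpret annulus a b using assms(2,3) by unfold_locales
  have "weak_laplacian \<Omega> u x + 2 * (m - 1) * ((x /\<^sub>R (norm x)\<^sup>2) \<bullet> weak_gradient \<Omega> u x)
      + (m - 1)\<^sup>2 / (norm x)\<^sup>2 * u x
    = conj_laplacian m (\<lambda>x. weak_deriv \<Omega> [1, 1] u x + weak_deriv \<Omega> [2, 2] u x)
          (weak_deriv \<Omega> [1] u) (weak_deriv \<Omega> [2] u) u x" for x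
    by (simp add: conj_laplacian_def weak_laplacian_def weak_gradient_def inner_vec_def sum_2 divide_inverse algebra_simps)
  moreover have "(u x)\<^sup>2 / (norm x) ^ 4 = (1 / (norm x)\<^sup>2 * u x)\<^sup>2" for x
    by (simp add: power_mult_distrib power_divide flip: power_mult)
  ultimately show ?thesis
    using sobolev_inequality[of u m] assms(4,6) by (simp add: freq_def power_divide)
qed

end
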